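(* Take any $p\in(0,\infty)$, $r\in\mathbb{R}$, and $u\in\mathbb{R}$. Take any real-valued random variable $X$ such that $\mathsf{E}|X|^r+\mathsf{E}|X|^{r+p}<\infty$. Let $f$ be the characteristic function of $X$, and let $\ell:=\lceil p-1\rceil$. Then $$\mathsf{E}X_+^{r+p}e^{iuX}=\frac{f^{(p+r)}(u)}{2i^{p+r}}\,\mathsf{I}\{p\in\mathbb{N}\}+\frac{\Gamma(p+1)}{2\pi i^r}\int_0^\infty\Big(\frac{(R_\ell f^{(r)})(u;t)}{(it)^{p+1}}+\frac{(R_\ell f^{(r)})(u;-t)}{(-it)^{p+1}}\Big)\,dt,$$ where the integral exists in the Lebesgue sense (and is finite).
   Context: $\mathbb{N}=\{1,2,\dots\}$; $\mathsf{I}\{\cdot\}$ is the indicator. The $m$th-order Taylor remainder of a function $\psi$ is $(R_m\psi)(u;\delta):=\psi(u+\delta)-\sum_{j=0}^m\psi^{(j)}(u)\frac{\delta^j}{j!}$. For real $x$ and $s$: $x_+^s:=x^s$ if $x>0$ and $x_+^s:=0$ otherwise. In moments such as $\mathsf{E}|X|^s$, $0^s=\infty$ if $s<0$. For nonzero complex $z$, $\arg z\in(-\pi,\pi]$ and $z^s:=|z|^s e^{is\arg z}$; the bar denotes complex conjugation. Fractional derivatives: for $h\colon\mathbb{R}\to\mathbb{C}$ and real $s$, $h^{(s)}(t)$ is defined as follows (whenever the operations make sense). If $s\in\{0,1,2,\dots\}$, it is the usual derivative, $h^{(0)}=h$. If $s>0$ is not an integer, $k=\lfloor s\rfloor$,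 $\lambda=s-k$, then $h^{(s)}(t):=\frac1{\Gamma(-\lambda)}\int_0^\infty\frac{h^{(k)}(t-v)-h^{(k)}(t)}{v^{1+\lambda}}\,dv$. If $s\in(-1,0)$, then $h^{(s)}(t):=\frac1{\Gamma(-s)}\lim_{T\to\infty}\int_0^{T}\frac{h(t-v)}{v^{1+s}}\,dv$. If $s$ is a negative integer, $h^{(s)}(t):=\lim_{q\downarrow s}h^{(q)}(t)$. If $s<-1$ is not an integer, $h^{(s)}(t):=(h^{(\lceil s\rceil)})^{(s-\lceil s\rceil)}(t)$. If $f$ is the characteristic function of a random variable $X$ with $\mathsf{E}|X|^s<\infty$, then $f^{(s)}(t)$ exists and $f^{(s)}(t)=i^s\,\mathsf{E}\,\overline{X^s}e^{itX}$ for all real $t$ (with $X^0:=1$ when $s=0$). *)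

theory Defs
  imports "HOL-Probability.Probability"
begin

(* |x|^s as it enters moments, with 0^s = \<infinity> for s < 0 and 0^0 = 1;
   in contrast, 0 powr s = 0 for every s. *)
definition abs_power :: "real \<Rightarrow> real \<Rightarrow> ennreal" where
  "abs_power x s =
     (if x = 0 then (if s < 0 then \<infinity> else if s = 0 then 1 else 0)
      else ennreal (\<bar>x\<bar> powr s))"

definition abs_moment :: "'a measure \<Rightarrow> ('a \<Rightarrow> real) \<Rightarrow> real \<Rightarrow> ennreal" where
  "abs_moment M X s = (\<integral>\<^sup>+ \<omega>. abs_power (X \<omega>) s \<partial>M)"

definition pos_power :: "real \<Rightarrow> real \<Rightarrow> real" where
  "pos_power x s = (if x > 0 then x powr s else 0)"

definition nth_deriv :: "nat \<Rightarrow> (real \<Rightarrow> complex) \<Rightarrow> real \<Rightarrow> complex" where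
  "nth_deriv k h = ((\<lambda>g t. vector_derivative g (at t)) ^^ k) h"

definition taylor_rem :: "nat \<Rightarrow> (real \<Rightarrow> complex) \<Rightarrow> real \<Rightarrow> real \<Rightarrow> complex" where
  "taylor_rem m \<psi> u \<delta> =
     \<psi> (u + \<delta>) - (\<Sum>j=0..m. nth_deriv j \<psi> u * of_real (\<delta> ^ j / fact j))"

(* h^{(s)} for -1 < s < 0 *)
definition frac_int :: "real \<Rightarrow> (real \<Rightarrow> complex) \<Rightarrow> real \<Rightarrow> complex" where
  "frac_int s h t =
     of_real (1 / Gamma (- s)) *
     Lim at_top (\<lambda>T. set_lebesgue_integral lebesgue {0<..<T}
                       (\<lambda>v. h (t - v) / of_real (v powr (1 + s))))"

(* h^{(-n)}, defined as the limit of h^{(q)} as q decreases to -n.  Only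
   q in (-(n+1), -n) matters for the limit at -(n+1); there \<lceil>q\<rceil> = -n, so
   h^{(q)} is the derivative of order q + n of h^{(-n)}. *)
primrec neg_int_deriv :: "nat \<Rightarrow> (real \<Rightarrow> complex) \<Rightarrow> real \<Rightarrow> complex" where
  "neg_int_deriv 0 h = h"
| "neg_int_deriv (Suc n) h =
     (\<lambda>t. Lim (at_right (- real (Suc n)))
            (\<lambda>q. frac_int (q + real n) (neg_int_deriv n h) t))"

(* The last branch also covers -1 < s < 0, where \<lceil>s\<rceil> = 0. *)
definition frac_deriv :: "real \<Rightarrow> (real \<Rightarrow> complex) \<Rightarrow> real \<Rightarrow> complex" where
  "frac_deriv s h t =
     (if s \<in> \<nat> then nth_deriv (nat \<lfloor>s\<rfloor>) h t
      else if s > 0 then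
        of_real (1 / Gamma (- frac s)) *
        set_lebesgue_integral lebesgue {0<..}
          (\<lambda>v. (nth_deriv (nat \<lfloor>s\<rfloor>) h (t - v) - nth_deriv (nat \<lfloor>s\<rfloor>) h t)
                / of_real (v powr (1 + frac s)))
      else if s \<in> \<int> then neg_int_deriv (nat (- \<lfloor>s\<rfloor>)) h t
      else frac_int (s - of_int \<lceil>s\<rceil>) (neg_int_deriv (nat (- \<lceil>s\<rceil>)) h) t)"

lemma frac_deriv_of_nat: "frac_deriv (real n) h = nth_deriv n h"
  by (rule ext) (simp add: frac_deriv_def)

lemma frac_deriv_neg_of_nat: "frac_deriv (- real n) h = neg_int_deriv n h"
proof (cases "n = 0")
  case True
  then show ?thesis
    by (intro ext) (simp add: frac_deriv_def nth_deriv_def)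
next
  case False
  then have "- real n \<notin> \<nat>"
    by (auto elim!: Nats_cases)
  moreover have "\<lfloor>- real n\<rfloor> = - int n"
    by linarith
  ultimately show ?thesis
    by (intro ext) (simp add: frac_deriv_def)
qed

lemma frac_deriv_between_m1_0:
  assumes "-1 < s" "s < 0"
  shows "frac_deriv s h = frac_int s h"
proof -
  have c: "\<lceil>s\<rceil> = 0"
    using assms by linarith
  have "s \<notin> \<int>"
    using assms by (auto elim!: Ints_cases)
  moreover from this have "s \<notin> \<nat>"
    using Nats_subset_Ints by blast
  ultimately show ?thesis
    using assms c by (intro ext) (simp add: frac_deriv_def)
qed

lemma frac_deriv_neg_nonint:
  assumes "s < 0" "s \<notin> \<int>"
  shows "frac_deriv s h = frac_deriv (s - of_int \<lceil>s\<rceil>) (frac_deriv (of_int \<lceil>s\<rceil>) h)"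
proof -
  have "s \<noteq> of_int \<lceil>s\<rceil>"
    using assms(2) by (metis Ints_of_int)
  then have b: "-1 < s - of_int \<lceil>s\<rceil>" "s - of_int \<lceil>s\<rceil> < 0"
    by linarith+
  have "\<lceil>s\<rceil> \<le> 0"
    using assms(1) by linarith
  then have "of_int \<lceil>s\<rceil> = - real (nat (- \<lceil>s\<rceil>))"
    by simp
  then have "frac_deriv (of_int \<lceil>s\<rceil>) h = neg_int_deriv (nat (- \<lceil>s\<rceil>)) h"
    using frac_deriv_neg_of_nat by metis
  moreover have "s \<notin> \<nat>"
    using assms(2) Nats_subset_Ints by blast
  ultimately show ?thesis
    using assms by (intro ext) (simp add: frac_deriv_between_m1_0[OF b], simp add: frac_deriv_def)
qed

lemma frac_deriv_neg_int:
  assumes "n > 0"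
  shows "frac_deriv (- real n) h t = Lim (at_right (- real n)) (\<lambda>q. frac_deriv q h t)"
proof -
  obtain m where n: "n = Suc m"
    using assms gr0_implies_Suc by blast
  have "frac_int (q + real m) (neg_int_deriv m h) t = frac_deriv q h t"
    if "- real n < q" "q < - real m" for q
  proof -
    have c: "\<lceil>q\<rceil> = - int m"
      using that n by linarith
    have "q \<notin> \<int>"
      using that c by (auto elim!: Ints_cases)
    moreover have "q < 0"
      using that by linarith
    moreover have "- 1 < q + real m" "q + real m < 0"
      using that n by linarith+
    ultimately show ?thesis
      using frac_deriv_neg_nonint[of q h]
      by (simp add: c frac_deriv_neg_of_nat frac_deriv_between_m1_0)
  qed
  then have "\<forall>\<^sub>F q in at_right (- real n).
      frac_int (q + real m) (neg_int_deriv m h) t = frac_deriv q h t"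
    unfolding eventually_at_right_field
    by (intro exI[of _ "- real m"]) (auto simp: n)
  then have "((\<lambda>q. frac_int (q + real m) (neg_int_deriv m h) t) \<longlongrightarrow> l) (at_right (- real n))
      \<longleftrightarrow> ((\<lambda>q. frac_deriv q h t) \<longlongrightarrow> l) (at_right (- real n))" for l
    by (rule tendsto_cong)
  then have "Lim (at_right (- real n)) (\<lambda>q. frac_int (q + real m) (neg_int_deriv m h) t)
      = Lim (at_right (- real n)) (\<lambda>q. frac_deriv q h t)"
    by (simp add: Topological_Spaces.Lim_def)
  then show ?thesis
    by (simp only: frac_deriv_neg_of_nat n neg_int_deriv.simps)
qed

end

(* The random variable enters only through integrals of kernels. Writing (ix)^s for the principal
   power, f^(s)(t) = E (iX)^s e^{itX} for every s with a finite moment: for fractional s this is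
   Fubini's theorem together with the integral of (e^{-ixv} - 1) / v^{1+b} over v > 0, which equals
   Gamma(-b) (ix)^b and is obtained as the boundary value of the Laplace transform of a power.
   Hence the Taylor remainder of f^(r) at u is E (iX)^r e^{iuX} rho(itX), rho being the remainder
   of the exponential series, and by Fubini the integral of the theorem is E (iX)^r e^{iuX} K(X)
   with K(x) = int_0^oo (rho(itx) / (it)^{p+1} + rho(-itx) / (-it)^{p+1}) dt. Integration by parts
   gives K_p(x) = (x/p) K_{p-1}(x), which reduces the value of K to 0 < p < 1 (the integral above)
   and p = 1 (the sine integral). *)
theory Submission
  imports Defs
begin

subsection \<open>Integrals over the half-line\<close>

text \<open>For real x other than 0, i^s times the conjugate of x^s is the principal power (ix)^s,
  because ix has argument pi/2 or -pi/2; one formula thus serves both signs of x. Two obstacles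
  shape the estimates. For -1 < s < 0 the integral of e^{-ixv} / v^{1+s} converges only
  conditionally at infinity. Integration by parts against e^{-ixv} - 1 expresses its truncations
  through an absolutely convergent integral and bounds them by C |x|^s uniformly in T, so that the
  limit may pass under the expectation. For natural p the two halves of the integrand are not
  separately integrable near 0, hence they are kept in one kernel. Up to the Gamma factor that
  kernel yields sgn(x) x^p / 2 instead of x_+^p, and the missing x^p / 2 is the origin of the term
  with f^(p+r). The absolute bounds for Fubini come from homogeneity: x and v enter through the
  product xv and a power of v, so the absolute integrals scale like |x|^b and |x|^p.\<close>

lemma tendsto_comp_real_of_ereal_at_right:
  assumes "(F \<longlongrightarrow> A) (at_right (a::real))"
  shows "((F \<circ> real_of_ereal) \<longlongrightarrow> A) (at_right (ereal a))"
  unfolding comp_def ereal_tendsto_simps1(2)[unfolded comp_def] using assms .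

text \<open>Only limits of \<open>B\<close> at 0 and at infinity are asked for, because later
  antiderivatives are built from factors such as \<open>v powr (- b)\<close> or \<open>1 / t\<close>
  that are singular at 0.\<close>

lemma integral_FTC_Ioi:
  fixes B b :: "real \<Rightarrow> complex"
  assumes "\<And>v. v > 0 \<Longrightarrow> (B has_vector_derivative b v) (at v)"
    and "continuous_on {0<..} b" and "set_integrable lborel {0<..} b"
    and "(B \<longlongrightarrow> L0) (at_right 0)" and "(B \<longlongrightarrow> L1) at_top"
  shows "(LINT v:{0<..}|lborel. b v) = L1 - L0"
proof -
  have e: "einterval 0 \<infinity> = {0<..}"
    by (auto simp: einterval_def zero_ereal_def)
  have "(LBINT x=0..\<infinity>. b x) = L1 - L0"
  proof (rule interval_integral_FTC_integrable)
    show "isCont b x" if "0 < ereal x" "ereal x < \<infinity>" for x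
      using assms(2) that by (auto simp: continuous_on_eq_continuous_at zero_ereal_def)
    show "set_integrable lborel (einterval 0 \<infinity>) b"
      using assms(3) by (simp add: e)
    show "((B \<circ> real_of_ereal) \<longlongrightarrow> L0) (at_right 0)"
      using tendsto_comp_real_of_ereal_at_right[OF assms(4)] by (simp add: zero_ereal_def)
    show "((B \<circ> real_of_ereal) \<longlongrightarrow> L1) (at_left \<infinity>)"
      using assms(5) by (simp add: ereal_tendsto_simps)
  qed (use assms(1) in \<open>auto simp: zero_ereal_def\<close>)
  then show ?thesis
    by (simp add: interval_lebesgue_integral_def e)
qed

lemma integral_FTC_Ioo:
  fixes B b :: "real \<Rightarrow> complex"
  assumes "T > 0" and "\<And>v. v > 0 \<Longrightarrow> (B has_vector_derivative b v) (at v)"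
    and "continuous_on {0<..} b" and "set_integrable lborel {0<..<T} b"
    and "(B \<longlongrightarrow> L0) (at_right 0)"
  shows "(LINT v:{0<..<T}|lborel. b v) = B T - L0"
proof -
  have e: "einterval 0 (ereal T) = {0<..<T}"
    by (auto simp: einterval_def zero_ereal_def)
  have "(LBINT x=0..ereal T. b x) = B T - L0"
  proof (rule interval_integral_FTC_integrable)
    show "isCont b x" if "0 < ereal x" "ereal x < ereal T" for x
      using assms(3) that by (auto simp: continuous_on_eq_continuous_at zero_ereal_def)
    show "set_integrable lborel (einterval 0 (ereal T)) b"
      using assms(4) by (simp add: e)
    show "((B \<circ> real_of_ereal) \<longlongrightarrow> L0) (at_right 0)"
      using tendsto_comp_real_of_ereal_at_right[OF assms(5)] by (simp add: zero_ereal_def)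
    have "isCont B T"
      using assms(1,2) has_vector_derivative_continuous by blast
    then have "(B \<longlongrightarrow> B T) (at_left T)"
      by (simp add: isCont_def filterlim_at_split)
    then show "((B \<circ> real_of_ereal) \<longlongrightarrow> B T) (at_left (ereal T))"
      by (simp add: ereal_tendsto_simps)
  qed (use assms(1,2) in \<open>auto simp: zero_ereal_def\<close>)
  then show ?thesis
    using assms(1) by (simp add: interval_lebesgue_integral_def e)
qed

lemma set_integrable_Ioi_scale:
  fixes g :: "real \<Rightarrow> complex"
  assumes "c > 0" and "set_integrable lborel {0<..} g"
  shows "set_integrable lborel {0<..} (\<lambda>v. g (c * v))"
  using lborel_integrable_real_affine[of "\<lambda>v. indicator {0<..} v *\<^sub>R g v" c 0] assms
  by (simp add: set_integrable_def indicator_def zero_less_mult_iff)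

lemma integral_Ioi_scale:
  fixes g :: "real \<Rightarrow> 'b::{banach, second_countable_topology}"
  assumes "c > 0"
  shows "(LINT v:{0<..}|lborel. g (c * v)) = (LINT v:{0<..}|lborel. g v) /\<^sub>R c"
  using lborel_integral_real_affine[of c "\<lambda>v. indicator {0<..} v *\<^sub>R g v" 0] assms
  by (simp add: set_lebesgue_integral_def indicator_def zero_less_mult_iff)

lemma set_integrable_powr_Ioc:
  assumes "a > (-1::real)"
  shows "set_integrable lborel {0<..T} (\<lambda>v. v powr a)"
proof (cases "T \<ge> 0")
  case True
  have "(\<lambda>v. v powr a) integrable_on {0..T}"
    using integrable_on_powr_from_0[OF assms True] .
  \<comment> \<open>Nonnegativity turns the gauge integral into an absolute one;
    \<open>integrable_completion\<close> then replaces \<open>lebesgue\<close> by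
    \<open>lborel\<close>.\<close>
  then have "(\<lambda>v. v powr a) absolutely_integrable_on {0..T}"
    by (intro nonnegative_absolutely_integrable_1) auto
  then have "(\<lambda>v. v powr a) absolutely_integrable_on {0<..T}"
    by (rule set_integrable_subset) auto
  then show ?thesis
    unfolding set_integrable_def by (subst (asm) integrable_completion) auto
qed (auto simp: set_integrable_def)

lemma set_integrable_powr_Ioi:
  assumes "b < (-1::real)"
  shows "set_integrable lborel {1<..} (\<lambda>v. v powr b)"
proof -
  have "(\<lambda>v. v powr b) integrable_on {1..}"
    using has_integral_powr_to_inf[OF assms, of 1] by auto
  then have "(\<lambda>v. v powr b) absolutely_integrable_on {1..}"
    by (intro nonnegative_absolutely_integrable_1) auto
  then have "(\<lambda>v. v powr b) absolutely_integrable_on {1<..}"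
    by (rule set_integrable_subset) auto
  then show ?thesis
    unfolding set_integrable_def by (subst (asm) integrable_completion) auto
qed

text \<open>Common majorant of the kernels below: \<open>a\<close> governs the origin and
  \<open>b\<close> infinity, so integrability on the half-line amounts to \<open>a > -1\<close> and
  \<open>b < -1\<close>.\<close>

definition powr_dom :: "real \<Rightarrow> real \<Rightarrow> real \<Rightarrow> real" where
  "powr_dom a b v = (if v \<le> 1 then v powr a else v powr b)"

lemma powr_dom_nonneg [simp]: "powr_dom a b v \<ge> 0"
  by (simp add: powr_dom_def)

lemma set_integrable_powr_dom:
  assumes "a > -1" "b < -1"
  shows "set_integrable lborel {0<..} (powr_dom a b)"
proof -
  have "set_integrable lborel ({0<..1} \<union> {1<..}) (powr_dom a b)"
  proof (rule set_integrable_Un)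
    show "set_integrable lborel {0<..1} (powr_dom a b)"
      using set_integrable_powr_Ioc[OF assms(1), of 1]
      by (rule set_integrable_cong[THEN iffD1, rotated -1]) (auto simp: powr_dom_def)
    show "set_integrable lborel {1<..} (powr_dom a b)"
      using set_integrable_powr_Ioi[OF assms(2)]
      by (rule set_integrable_cong[THEN iffD1, rotated -1]) (auto simp: powr_dom_def)
  qed auto
  moreover have "{0<..1} \<union> {1<..} = {(0::real)<..}" by auto
  ultimately show ?thesis by simp
qed

lemma set_integrable_Ioi_bound:
  fixes g :: "real \<Rightarrow> complex"
  assumes "continuous_on {0<..} g" "a > -1" "b < -1"
    and "\<And>v. v > 0 \<Longrightarrow> norm (g v) \<le> C * powr_dom a b v"
  shows "set_integrable lborel {0<..} g"
proof -
  have "set_integrable lborel {0<..} (\<lambda>v. C * powr_dom a b v)"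
    using set_integrable_powr_dom[OF assms(2,3)] by (rule set_integrable_mult_right)
  moreover have "set_borel_measurable lborel {0<..} g"
    unfolding set_borel_measurable_def
    using borel_measurable_continuous_on_indicator[OF _ assms(1)] by simp
  ultimately show ?thesis
    by (rule set_integrable_bound)
      (use assms(4) in \<open>auto intro!: AE_I2 order_trans[OF assms(4)]\<close>)
qed

text \<open>The exponents that make the majorant integrable also make
  \<open>v * powr_dom a b v\<close> vanish at both ends. This lemma and its companion at infinity
  dispose of the boundary terms in integrations by parts.\<close>

lemma tendsto_mult_powr_dom_0:
  assumes "a > -1"
  shows "((\<lambda>v. v * powr_dom a b v) \<longlongrightarrow> 0) (at_right 0)"
proof -
  have "((\<lambda>v::real. v powr (a + 1)) \<longlongrightarrow> 0) (at_right 0)"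
    using assms
    by (intro tendsto_eq_rhs[OF tendsto_powr'[where a = 0 and b = "a + 1"]])
      (auto intro!: tendsto_ident_at simp: eventually_at_filter)
  moreover have "\<forall>\<^sub>F v in at_right 0. v powr (a + 1) = v * powr_dom a b v"
    unfolding eventually_at_right_field
    by (intro exI[of _ 1]) (auto simp: powr_dom_def powr_add)
  ultimately show ?thesis
    by (rule Lim_transform_eventually)
qed

lemma tendsto_mult_powr_dom_at_top:
  assumes "b < -1"
  shows "((\<lambda>v. v * powr_dom a b v) \<longlongrightarrow> 0) at_top"
proof -
  have "((\<lambda>v::real. v powr (b + 1)) \<longlongrightarrow> 0) at_top"
    using assms by (intro tendsto_neg_powr filterlim_ident) auto
  moreover have "\<forall>\<^sub>F v in at_top. v powr (b + 1) = v * powr_dom a b v"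
    using eventually_gt_at_top[of 1]
    by eventually_elim (auto simp: powr_dom_def powr_add)
  ultimately show ?thesis
    by (rule Lim_transform_eventually)
qed

section \<open>Differentiation under the integral sign\<close>

lemma has_vector_derivative_iff_quotient:
  fixes f :: "real \<Rightarrow> 'a::real_normed_vector"
  shows "(f has_vector_derivative D) (at x) \<longleftrightarrow> ((\<lambda>h. (f (x + h) - f x) /\<^sub>R h) \<longlongrightarrow> D) (at 0)"
proof -
  have "(f has_vector_derivative D) (at x) \<longleftrightarrow>
      ((\<lambda>h. norm (f (x + h) - f x - h *\<^sub>R D) / norm h) \<longlongrightarrow> 0) (at 0)"
    by (auto simp: has_vector_derivative_def has_derivative_at bounded_linear_scaleR_left)
  also have "\<dots> \<longleftrightarrow> ((\<lambda>h. norm ((f (x + h) - f x) /\<^sub>R h - D)) \<longlongrightarrow> 0) (at 0)"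
  proof (rule tendsto_cong)
    have "norm (f (x + h) - f x - h *\<^sub>R D) / norm h = norm ((f (x + h) - f x) /\<^sub>R h - D)"
      if "h \<noteq> 0" for h
    proof -
      have "(f (x + h) - f x) /\<^sub>R h - D = (f (x + h) - f x - h *\<^sub>R D) /\<^sub>R h"
        using that by (simp add: scaleR_diff_right)
      then show ?thesis
        by (simp add: divide_inverse_commute)
    qed
    then show "\<forall>\<^sub>F h in at 0. norm (f (x + h) - f x - h *\<^sub>R D) / norm h =
        norm ((f (x + h) - f x) /\<^sub>R h - D)"
      by (auto simp: eventually_at_filter)
  qed
  also have "\<dots> \<longleftrightarrow> ((\<lambda>h. (f (x + h) - f x) /\<^sub>R h) \<longlongrightarrow> D) (at 0)"
    by (simp add: tendsto_norm_zero_iff LIM_zero_iff)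
  finally show ?thesis .
qed

text \<open>The measure is not assumed finite: besides distributions, this is applied to Lebesgue
  measure on the half-line.\<close>

lemma has_vector_derivative_fourier:
  fixes w :: "'a \<Rightarrow> complex" and Y :: "'a \<Rightarrow> real"
  assumes Y[measurable]: "Y \<in> borel_measurable N"
    and w: "integrable N w" and wY: "integrable N (\<lambda>x. of_real (Y x) * w x)"
  shows "((\<lambda>t. \<integral>x. w x * iexp (t * Y x) \<partial>N) has_vector_derivative
    (\<integral>x. \<i> * of_real (Y x) * w x * iexp (t * Y x) \<partial>N)) (at t)"
proof -
  have [measurable]: "w \<in> borel_measurable N" using w by simp
  have i: "integrable N (\<lambda>x. w x * iexp (s * Y x))" for s
    by (rule Bochner_Integration.integrable_bound[OF w]) (auto simp: norm_mult)
  have "((\<lambda>h. \<integral>x. (w x * iexp ((t + h) * Y x) - w x * iexp (t * Y x)) /\<^sub>R h \<partial>N) \<longlongrightarrow>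
      (\<integral>x. \<i> * of_real (Y x) * w x * iexp (t * Y x) \<partial>N)) (at 0)"
    unfolding tendsto_at_iff_sequentially comp_def
  proof (intro allI impI)
    fix h :: "nat \<Rightarrow> real"
    assume h0: "\<forall>i. h i \<in> UNIV - {0}" and h: "h \<longlonglongrightarrow> 0"
    have hh: "filterlim h (at 0) sequentially"
      using h h0 by (simp add: filterlim_at)
    show "(\<lambda>n. \<integral>x. (w x * iexp ((t + h n) * Y x) - w x * iexp (t * Y x)) /\<^sub>R h n \<partial>N) \<longlonglongrightarrow>
      (\<integral>x. \<i> * of_real (Y x) * w x * iexp (t * Y x) \<partial>N)"
    proof (rule integral_dominated_convergence)
      show "integrable N (\<lambda>x. norm (of_real (Y x) * w x))"
        using wY by simp
      show "AE x in N. (\<lambda>n. (w x * iexp ((t + h n) * Y x) - w x * iexp (t * Y x)) /\<^sub>R h n)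
          \<longlonglongrightarrow> \<i> * of_real (Y x) * w x * iexp (t * Y x)"
      proof (rule AE_I2)
        fix x
        have "((\<lambda>s. w x * iexp (s * Y x)) has_vector_derivative
            w x * (of_real (Y x) * (\<i> * iexp (t * Y x)))) (at t)"
          unfolding of_real_mult
          by (rule has_vector_derivative_real_field) (auto intro!: derivative_eq_intros)
        then have "((\<lambda>h. (w x * iexp ((t + h) * Y x) - w x * iexp (t * Y x)) /\<^sub>R h) \<longlongrightarrow>
            w x * (of_real (Y x) * (\<i> * iexp (t * Y x)))) (at 0)"
          by (simp add: has_vector_derivative_iff_quotient)
        from filterlim_compose[OF this hh]
        show "(\<lambda>n. (w x * iexp ((t + h n) * Y x) - w x * iexp (t * Y x)) /\<^sub>R h n)
          \<longlonglongrightarrow> \<i> * of_real (Y x) * w x * iexp (t * Y x)"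
          by (simp add: mult_ac)
      qed
      show "AE x in N. norm ((w x * iexp ((t + h n) * Y x) - w x * iexp (t * Y x)) /\<^sub>R h n)
          \<le> norm (of_real (Y x) * w x)" for n
      proof (rule AE_I2)
        fix x
        have "w x * iexp ((t + h n) * Y x) - w x * iexp (t * Y x) =
            w x * iexp (t * Y x) * (iexp (h n * Y x) - 1)"
          by (simp add: algebra_simps exp_add)
        \<comment> \<open>This bound cancels the \<open>h n\<close> of the difference quotient, so
          the majorant |Y w| does not depend on \<open>n\<close>.\<close>
        moreover have "cmod (iexp (h n * Y x) - 1) \<le> \<bar>h n\<bar> * \<bar>Y x\<bar>"
          using iexp_approx1[of "h n * Y x" 0] by (simp add: abs_mult)
        ultimately have "norm (w x * iexp ((t + h n) * Y x) - w x * iexp (t * Y x)) \<le>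
            norm (w x) * (\<bar>h n\<bar> * \<bar>Y x\<bar>)"
          by (simp add: norm_mult mult_left_mono)
        then show "norm ((w x * iexp ((t + h n) * Y x) - w x * iexp (t * Y x)) /\<^sub>R h n)
          \<le> norm (of_real (Y x) * w x)"
          using h0 by (simp add: norm_mult divide_simps mult_ac)
      qed
    qed auto
  qed
  also have "(\<lambda>h. \<integral>x. (w x * iexp ((t + h) * Y x) - w x * iexp (t * Y x)) /\<^sub>R h \<partial>N) =
      (\<lambda>h. ((\<integral>x. w x * iexp ((t + h) * Y x) \<partial>N) - (\<integral>x. w x * iexp (t * Y x) \<partial>N)) /\<^sub>R h)"
    by (intro ext) (simp only: Bochner_Integration.integral_diff[OF i i] integral_scaleR_right)
  finally show ?thesis
    by (simp add: has_vector_derivative_iff_quotient)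
qed

subsection \<open>Complex powers and the Gamma integral\<close>

text \<open>\<open>0 powr 0 = 0\<close>, whereas an atom of the distribution at \<open>0\<close> must count with weight \<open>X\<^sup>0 = 1\<close>.\<close>

definition ipow :: "real \<Rightarrow> real \<Rightarrow> complex" where
  "ipow s x = (if x = 0 then of_bool (s = 0) else (\<i> * of_real x) powr of_real s)"

text \<open>The argument of ix is \<open>sgn x * (pi / 2)\<close>, inside the principal strip, so
  \<open>Ln\<close> inverts the exponential without a correction.\<close>

lemma ii_times_powr:
  fixes x s :: real
  assumes "x \<noteq> 0"
  shows "(\<i> * of_real x) powr of_real s = of_real (\<bar>x\<bar> powr s) * cis (sgn x * (pi * s / 2))"
proof -
  have "\<i> * of_real x = of_real \<bar>x\<bar> * cis (sgn x * (pi / 2))"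
    using assms by (cases "x > 0") (auto simp: complex_eq_iff)
  also have "of_real \<bar>x\<bar> = exp (complex_of_real (ln \<bar>x\<bar>))"
    using assms by (simp add: exp_of_real)
  also have "\<dots> * cis (sgn x * (pi / 2)) = exp (of_real (ln \<bar>x\<bar>) + \<i> * of_real (sgn x * (pi / 2)))"
    by (simp only: exp_add cis_conv_exp)
  finally have e: "\<i> * of_real x = exp (of_real (ln \<bar>x\<bar>) + \<i> * of_real (sgn x * (pi / 2)))" .
  have "Ln (\<i> * of_real x) = of_real (ln \<bar>x\<bar>) + \<i> * of_real (sgn x * (pi / 2))"
    unfolding e by (rule Ln_exp) (use assms in \<open>auto simp: sgn_if\<close>)
  then have "(\<i> * of_real x) powr of_real s =
      exp (of_real (s * ln \<bar>x\<bar>)) * exp (\<i> * of_real (sgn x * (pi * s / 2)))"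
    using assms by (simp add: powr_def exp_add[symmetric] algebra_simps)
  then show ?thesis
    using assms by (simp add: powr_def cis_conv_exp flip: exp_of_real)
qed

lemma ipow_conv_cis:
  "x \<noteq> 0 \<Longrightarrow> ipow s x = of_real (\<bar>x\<bar> powr s) * cis (sgn x * (pi * s / 2))"
  by (simp add: ipow_def ii_times_powr)

lemma norm_ipow: "x \<noteq> 0 \<Longrightarrow> norm (ipow s x) = \<bar>x\<bar> powr s"
  by (simp add: ipow_conv_cis norm_mult)

lemma ipow_0 [simp]: "ipow 0 x = 1"
  by (auto simp: ipow_def)

lemma ipow_add: "x \<noteq> 0 \<Longrightarrow> ipow (s + t) x = ipow s x * ipow t x"
  by (simp add: ipow_def powr_add)

lemma ipow_of_nat: "ipow (real n) x = (\<i> * of_real x) ^ n"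
  using powr_nat'[of "\<i> * of_real x" n] by (auto simp: ipow_def)

lemma ipow_measurable [measurable]: "ipow s \<in> borel_measurable borel"
proof -
  have "ipow s = (\<lambda>x. if x = 0 then of_bool (s = 0) else of_real (\<bar>x\<bar> powr s) * cis (sgn x * (pi * s / 2)))"
    by (auto simp: ipow_conv_cis fun_eq_iff) (simp add: ipow_def)
  also have "\<dots> \<in> borel_measurable borel"
    unfolding cis_conv_exp by measurable
  finally show ?thesis .
qed

section \<open>The Gamma integral with a complex parameter\<close>

lemma set_integrable_gamma:
  assumes "a > (0::real)"
  shows "set_integrable lborel {0<..} (\<lambda>v. v powr (a - 1) * exp (- v))"
    and "(LINT v:{0<..}|lborel. v powr (a - 1) * exp (- v)) = Gamma a"
proof -
  have h: "((\<lambda>v. v powr (a - 1) * exp (- v)) has_integral Gamma a) {0..}"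
    using Gamma_integral_real[OF assms] by (simp add: exp_minus divide_inverse)
  then have "(\<lambda>v. v powr (a - 1) * exp (- v)) absolutely_integrable_on {0..}"
    by (intro nonnegative_absolutely_integrable_1) auto
  then have i: "(\<lambda>v. v powr (a - 1) * exp (- v)) absolutely_integrable_on {0<..}"
    by (rule set_integrable_subset) auto
  then show ii: "set_integrable lborel {0<..} (\<lambda>v. v powr (a - 1) * exp (- v))"
    unfolding set_integrable_def by (subst (asm) integrable_completion) auto
  have "((\<lambda>v. v powr (a - 1) * exp (- v)) has_integral Gamma a) {0<..}"
    by (rule has_integral_spike_set_eq[THEN iffD1, OF _ _ h])
      (auto intro!: negligible_subset[OF negligible_sing, of _ 0])
  moreover have "((\<lambda>v. v powr (a - 1) * exp (- v)) has_integral
      (LINT v:{0<..}|lborel. v powr (a - 1) * exp (- v))) {0<..}"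
    using has_integral_set_lebesgue[OF i] 
    by (simp add: has_integral_set_lebesgue[OF i] set_lebesgue_integral_def integral_completion)
  ultimately show "(LINT v:{0<..}|lborel. v powr (a - 1) * exp (- v)) = Gamma a"
    using has_integral_unique by blast
qed

lemma set_integrable_gamma_fourier:
  assumes "a > (0::real)"
  shows "set_integrable lborel {0<..} (\<lambda>v. of_real (v powr (a - 1) * exp (- v)) * iexp (y * v))"
  by (rule set_integrable_bound[OF set_integrable_gamma(1)[OF assms]])
    (auto simp: norm_mult set_borel_measurable_def)

text \<open>A differential equation takes the place of a contour rotation. Writing
  \<open>H a y\<close> for the integral, the y-derivative of \<open>H a\<close> is
  \<open>\<i> * H (a + 1) y\<close>, and integration by parts gives
  \<open>a * H a y = (1 - \<i> * y) * H (a + 1) y\<close>. Hence (1 - iy)^a \<open>H a y\<close> is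
  constant in y, and y = 0 gives the Gamma value.\<close>

lemma integral_gamma_fourier:
  assumes "a > (0::real)"
  shows "(LINT v:{0<..}|lborel. of_real (v powr (a - 1) * exp (- v)) * iexp (y * v)) =
    of_real (Gamma a) * (1 - \<i> * of_real y) powr (- of_real a)"
proof -
  define H where "H b y = (LINT v:{0<..}|lborel. of_real (v powr (b - 1) * exp (- v)) * iexp (y * v))" for b y
  define w :: "real \<Rightarrow> complex" where "w v = indicator {0<..} v *\<^sub>R of_real (v powr (a - 1) * exp (- v))" for v
  have vw: "of_real v * w v = indicator {0<..} v *\<^sub>R of_real (v powr (a + 1 - 1) * exp (- v))" for v
    by (auto simp: w_def indicator_def powr_diff)
  have w: "integrable lborel w"
    using set_integrable_gamma_fourier[OF assms, of 0] by (simp add: w_def[abs_def] set_integrable_def)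
  have w': "integrable lborel (\<lambda>v. of_real v * w v)"
    unfolding vw using set_integrable_gamma_fourier[of "a + 1" 0] assms by (simp add: set_integrable_def)
  have Hw: "H a = (\<lambda>y. \<integral>v. w v * iexp (y * v) \<partial>lborel)"
    by (intro ext) (simp add: H_def w_def set_lebesgue_integral_def)
  have H1w: "\<i> * H (a + 1) y = (\<integral>v. \<i> * of_real v * w v * iexp (y * v) \<partial>lborel)" for y
    unfolding mult.assoc[of \<i>] vw
    unfolding H_def set_lebesgue_integral_def integral_mult_right_zero[symmetric]
    by (intro Bochner_Integration.integral_cong) (auto simp: mult_ac)
  have D: "(H a has_vector_derivative \<i> * H (a + 1) y) (at y)" for y
    unfolding Hw H1w by (rule has_vector_derivative_fourier[where Y = "\<lambda>v. v", OF _ w w']) simp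
  have parts: "a * H a y = (1 - \<i> * of_real y) * H (a + 1) y" for y
  proof -
    define g where "g b v = of_real (v powr (b - 1) * exp (- v)) * iexp (y * v)" for b v
    have i: "set_integrable lborel {0<..} (g b)" if "b > 0" for b
      unfolding g_def[abs_def] using set_integrable_gamma_fourier[OF that] .
    \<comment> \<open>The antiderivative v^a e^{-v} e^{iyv} vanishes at both ends because a >
      0.\<close>
    have "(LINT v:{0<..}|lborel. a * g a v - (1 - \<i> * of_real y) * g (a + 1) v) = 0 - 0"
    proof (rule integral_FTC_Ioi[where B = "g (a + 1)"])
      fix v :: real assume v: "v > 0"
      have "((\<lambda>v. of_real (v powr a) * exp (of_real v * (\<i> * of_real y - 1))) has_vector_derivative
         of_real (a * v powr (a - 1)) * exp (of_real v * (\<i> * of_real y - 1)) 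
         + of_real (v powr a) * ((\<i> * of_real y - 1) * exp (of_real v * (\<i> * of_real y - 1)))) (at v)"
      proof (rule has_vector_derivative_eq_rhs[OF has_vector_derivative_mult])
        show "((\<lambda>v. complex_of_real (v powr a)) has_vector_derivative of_real (a * v powr (a - 1))) (at v)"
          using has_real_derivative_powr[OF v, of a] by (rule has_vector_derivative_of_real)
        show "((\<lambda>v. exp (of_real v * (\<i> * of_real y - 1))) has_vector_derivative
            (\<i> * of_real y - 1) * exp (of_real v * (\<i> * of_real y - 1))) (at v)"
          by (rule has_vector_derivative_real_field) (auto intro!: derivative_eq_intros)
      qed simp
      moreover have e: "exp (of_real v * (\<i> * of_real y - 1)) = of_real (exp (- v)) * iexp (y * v)" for v
      proof -
        have "of_real v * (\<i> * of_real y - 1) = of_real (- v) + \<i> * of_real (y * v)"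
          by (simp add: algebra_simps)
        then show ?thesis
          by (simp only: exp_add exp_of_real)
      qed
      ultimately show "(g (a + 1) has_vector_derivative a * g a v - (1 - \<i> * of_real y) * g (a + 1) v) (at v)"
        unfolding g_def[abs_def] e by (simp add: algebra_simps)
    next
      have n: "norm (g (a + 1) v) = v powr a * exp (- v)" for v
        by (simp add: g_def norm_mult)
      have "((\<lambda>v. v powr a * exp (- v)) \<longlongrightarrow> 0 * exp (- 0)) (at_right 0)"
        using assms by (intro tendsto_intros tendsto_eq_rhs[OF tendsto_powr'[where a = 0 and b = a]])
          (auto simp: eventually_at_filter)
      then show "(g (a + 1) \<longlongrightarrow> 0) (at_right 0)"
        by (subst tendsto_norm_zero_iff[symmetric]) (simp add: n)
      have "((\<lambda>v. v powr a * exp (- v)) \<longlongrightarrow> 0) at_top"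
        using assms by real_asymp
      then show "(g (a + 1) \<longlongrightarrow> 0) at_top"
        by (subst tendsto_norm_zero_iff[symmetric]) (simp add: n)
    next
      show "continuous_on {0<..} (\<lambda>v. a * g a v - (1 - \<i> * of_real y) * g (a + 1) v)"
        unfolding g_def by (intro continuous_intros) auto
    next
      show "set_integrable lborel {0<..} (\<lambda>v. a * g a v - (1 - \<i> * of_real y) * g (a + 1) v)"
        using assms by (intro set_integral_diff set_integrable_mult_right i) auto
    qed
    also have "(LINT v:{0<..}|lborel. a * g a v - (1 - \<i> * of_real y) * g (a + 1) v) =
        a * H a y - (1 - \<i> * of_real y) * H (a + 1) y"
      using assms unfolding H_def g_def[symmetric]
      by (subst set_integral_diff) (auto intro!: set_integrable_mult_right i)
    finally show ?thesis by simp
  qed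
  have nz: "1 - \<i> * of_real y \<noteq> 0" for y
    by (simp add: complex_eq_iff)
  have nn: "1 - \<i> * of_real y \<notin> \<real>\<^sub>\<le>\<^sub>0" for y
    by (simp add: complex_nonpos_Reals_iff)
  \<comment> \<open>The power of 1 - iy is the integrating factor of the equation (1 - iy) H' = i a
    H.\<close>
  define G where "G y = (1 - \<i> * of_real y) powr of_real a * H a y" for y
  have "(G has_vector_derivative 0) (at y)" for y
  proof -
    have "((\<lambda>y. (1 - \<i> * of_real y) powr of_real a) has_vector_derivative
        of_real a * (1 - \<i> * of_real y) powr (of_real a - 1) * (- \<i>)) (at y)"
      using nn[of y] by (intro has_vector_derivative_real_field[where f = "\<lambda>z. (1 - \<i> * z) powr of_real a"])
        (auto intro!: derivative_eq_intros)
    from has_vector_derivative_mult[OF this D[of y]]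
    have "(G has_vector_derivative (1 - \<i> * of_real y) powr of_real a * (\<i> * H (a + 1) y) +
        of_real a * (1 - \<i> * of_real y) powr (of_real a - 1) * (- \<i>) * H a y) (at y)"
      unfolding G_def[abs_def] .
    also have "(1 - \<i> * of_real y) powr of_real a * (\<i> * H (a + 1) y) +
        of_real a * (1 - \<i> * of_real y) powr (of_real a - 1) * (- \<i>) * H a y =
        (1 - \<i> * of_real y) powr (of_real a - 1) * \<i> * ((1 - \<i> * of_real y) * H (a + 1) y - a * H a y)"
    proof -
      have "(1 - \<i> * of_real y) powr of_real a =
          (1 - \<i> * of_real y) powr (of_real a - 1) * (1 - \<i> * of_real y)"
        using nz[of y] by (simp add: powr_diff)
      then show ?thesis
        by (simp only:) (simp add: algebra_simps)
    qed
    finally show ?thesis by (simp add: parts)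
  qed
  then obtain c where "\<And>y. G y = c"
    using has_vector_derivative_zero_constant[of UNIV G] by auto
  then have "G y = G 0"
    by simp
  also have "G 0 = of_real (Gamma a)"
    using set_integrable_gamma(2)[OF assms] set_integral_complex_of_real[of lborel "{0<..}" "\<lambda>v. v powr (a - 1) * exp (- v)"]
    by (simp add: G_def H_def)
  finally show ?thesis
    using nz[of y] by (simp add: G_def H_def powr_minus divide_inverse[symmetric] eq_divide_eq mult.commute)
qed

text \<open>With z = eps (1 - iy) and eps = Re z > 0, substituting eps v for v reduces the integral
  to the line Re z = 1. The power of z splits accordingly because eps is a positive real.\<close>

lemma integral_gamma_laplace:
  assumes "a > (0::real)" "Re z > 0"
  shows "set_integrable lborel {0<..} (\<lambda>v. exp (- (z * of_real v)) * of_real (v powr (a - 1)))"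
    and "(LINT v:{0<..}|lborel. exp (- (z * of_real v)) * of_real (v powr (a - 1))) =
      of_real (Gamma a) * z powr (- of_real a)"
proof -
  define \<epsilon> where "\<epsilon> = Re z"
  define y where "y = - Im z / Re z"
  define g where "g v = of_real (v powr (a - 1) * exp (- v)) * iexp (y * v)" for v :: real
  have \<epsilon>: "\<epsilon> > 0" using assms by (simp add: \<epsilon>_def)
  have z: "z = of_real \<epsilon> * (1 - \<i> * of_real y)"
    using \<epsilon> by (simp add: complex_eq_iff \<epsilon>_def y_def)
  have e: "exp (- (z * of_real v)) = of_real (exp (- (\<epsilon> * v))) * iexp (y * (\<epsilon> * v))" for v
  proof -
    have "- (z * of_real v) = of_real (- (\<epsilon> * v)) + \<i> * of_real (y * (\<epsilon> * v))"
      by (simp add: z algebra_simps)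
    then show ?thesis by (simp only: exp_add exp_of_real)
  qed
  have g: "of_real (\<epsilon> powr (1 - a)) * g (\<epsilon> * v) = exp (- (z * of_real v)) * of_real (v powr (a - 1))"
    if "v > 0" for v
  proof -
    have "\<epsilon> powr (1 - a) * \<epsilon> powr (a - 1) = 1"
      using \<epsilon> by (simp add: powr_add[symmetric])
    then have "(\<epsilon> * v) powr (a - 1) * \<epsilon> powr (1 - a) = v powr (a - 1)"
      using that \<epsilon> by (simp add: powr_mult mult_ac)
    then show ?thesis
      unfolding g_def e by (simp flip: of_real_mult add: mult_ac)
  qed
  have "set_integrable lborel {0<..} (\<lambda>v. of_real (\<epsilon> powr (1 - a)) * g (\<epsilon> * v))"
    using set_integrable_gamma_fourier[OF assms(1), of y] \<epsilon> unfolding g_def[symmetric]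
    by (intro set_integrable_mult_right set_integrable_Ioi_scale) auto
  then show "set_integrable lborel {0<..} (\<lambda>v. exp (- (z * of_real v)) * of_real (v powr (a - 1)))"
    by (rule set_integrable_cong[THEN iffD1, rotated -1]) (auto simp: g)
  have "(LINT v:{0<..}|lborel. exp (- (z * of_real v)) * of_real (v powr (a - 1))) =
      (LINT v:{0<..}|lborel. of_real (\<epsilon> powr (1 - a)) * g (\<epsilon> * v))"
    by (rule set_lebesgue_integral_cong) (auto simp: g)
  also have "\<dots> = of_real (\<epsilon> powr (1 - a)) * ((LINT v:{0<..}|lborel. g v) /\<^sub>R \<epsilon>)"
    using \<epsilon> by (simp add: integral_Ioi_scale)
  also have "(LINT v:{0<..}|lborel. g v) = of_real (Gamma a) * (1 - \<i> * of_real y) powr (- of_real a)"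
    unfolding g_def using assms(1) by (rule integral_gamma_fourier)
  also have "of_real (\<epsilon> powr (1 - a)) * ((of_real (Gamma a) * (1 - \<i> * of_real y) powr (- of_real a)) /\<^sub>R \<epsilon>) =
     of_real (Gamma a) * (of_real (\<epsilon> powr (- a)) * (1 - \<i> * of_real y) powr (- of_real a))"
    using \<epsilon> by (simp add: scaleR_conv_of_real powr_diff powr_minus field_simps)
  also have "of_real (\<epsilon> powr (- a)) * (1 - \<i> * of_real y) powr (- of_real a) = z powr (- of_real a)"
    unfolding z using \<epsilon> by (subst powr_times_real_left) (auto simp: powr_of_real simp flip: of_real_minus)
  finally show "(LINT v:{0<..}|lborel. exp (- (z * of_real v)) * of_real (v powr (a - 1))) =
      of_real (Gamma a) * z powr (- of_real a)" .
qed

section \<open>The regularized integral of (e^{-zv} - 1) / v^{1+b} for Re z \<ge> 0\<close>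

lemma norm_exp_minus_one_le:
  assumes "Re z \<ge> 0"
  shows "norm (exp (- z) - 1) \<le> norm z" and "norm (exp (- z) - 1) \<le> 2"
proof -
  \<comment> \<open>Mean value inequality on the closed right half-plane, which is convex and where
    e^{-z} has modulus at most 1.\<close>
  have "norm (exp (- z) - exp (- 0)) \<le> 1 * norm (z - 0)"
  proof (rule field_differentiable_bound[where S = "{w. Re w \<ge> 0}" and f' = "\<lambda>z. - exp (- z)"])
    show "((\<lambda>z. exp (- z)) has_field_derivative - exp (- w)) (at w within {w. 0 \<le> Re w})" for w
      by (auto intro!: derivative_eq_intros)
  qed (use assms in \<open>auto simp: convex_halfspace_Re_ge\<close>)
  then show "norm (exp (- z) - 1) \<le> norm z" by simp
  show "norm (exp (- z) - 1) \<le> 2"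
    using norm_triangle_ineq4[of "exp (- z)" 1] assms by (simp add: norm_exp_eq_Re)
       (smt (verit) exp_le_one_iff)
qed

text \<open>The linear bound is used for v \<le> 1 and the constant bound beyond. The factor
  \<open>2 + norm z\<close> is kept explicit because the passage to the imaginary axis needs a bound
  uniform along a sequence of z.\<close>

lemma norm_exp_minus_one_powr_le:
  assumes "Re z \<ge> 0" "v > 0"
  shows "norm ((exp (- (z * of_real v)) - 1) / of_real (v powr (1 + b))) \<le>
    (2 + norm z) * powr_dom (- b) (- 1 - b) v"
proof -
  have 1: "norm (exp (- (z * of_real v)) - 1) \<le> norm z * v"
    and 2: "norm (exp (- (z * of_real v)) - 1) \<le> 2"
    using norm_exp_minus_one_le[of "z * of_real v"] assms by (auto simp: norm_mult)
  have n: "norm ((exp (- (z * of_real v)) - 1) / of_real (v powr (1 + b))) =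
      norm (exp (- (z * of_real v)) - 1) * v powr (- 1 - b)"
    using powr_minus[of v "1 + b"] by (simp add: norm_mult norm_inverse divide_inverse)
  show ?thesis
  proof (cases "v \<le> 1")
    case True
    have "norm (exp (- (z * of_real v)) - 1) * v powr (- 1 - b) \<le> (norm z * v) * v powr (- 1 - b)"
      using 1 by (rule mult_right_mono) simp
    also have "\<dots> = norm z * v powr (- b)"
      using assms(2) by (simp add: powr_diff powr_minus field_simps)
    also have "\<dots> \<le> (2 + norm z) * v powr (- b)"
      by (rule mult_right_mono) auto
    finally show ?thesis using True by (simp add: n powr_dom_def)
  next
    case False
    have "norm (exp (- (z * of_real v)) - 1) * v powr (- 1 - b) \<le> (2 + norm z) * v powr (- 1 - b)"
      using order_trans[OF 2, of "2 + norm z"] by (intro mult_right_mono) auto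
    then show ?thesis using False by (simp add: n powr_dom_def)
  qed
qed

lemma set_integrable_exp_minus_one_powr:
  assumes "0 < b" "b < 1" "Re z \<ge> 0"
  shows "set_integrable lborel {0<..} (\<lambda>v. (exp (- (z * of_real v)) - 1) / of_real (v powr (1 + b)))"
proof (rule set_integrable_Ioi_bound)
  show "continuous_on {0<..} (\<lambda>v. (exp (- (z * of_real v)) - 1) / of_real (v powr (1 + b)))"
    by (intro continuous_intros) auto
  show "norm ((exp (- (z * of_real v)) - 1) / of_real (v powr (1 + b))) \<le>
    (2 + norm z) * powr_dom (- b) (- 1 - b) v" if "v > 0" for v
    using that assms by (intro norm_exp_minus_one_powr_le) auto
qed (use assms in auto)

text \<open>This antiderivative links the regularized kernel to e^{-zv} v^{-b}. It serves twice: on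
  the half-line for Re z > 0, and on bounded intervals for imaginary z.\<close>

lemma has_vector_derivative_exp_minus_one_powr:
  fixes z :: complex
  assumes "v > (0::real)"
  shows "((\<lambda>v. (exp (- (z * of_real v)) - 1) * of_real (v powr (- b))) has_vector_derivative
    (- z * (exp (- (z * of_real v)) * of_real (v powr (- b))) -
      of_real b * ((exp (- (z * of_real v)) - 1) / of_real (v powr (1 + b))))) (at v)"
proof (rule has_vector_derivative_eq_rhs[OF has_vector_derivative_mult])
  show "((\<lambda>v. exp (- (z * of_real v)) - 1) has_vector_derivative - z * exp (- (z * of_real v))) (at v)"
    by (rule has_vector_derivative_real_field) (auto intro!: derivative_eq_intros)
  show "((\<lambda>v. complex_of_real (v powr (- b))) has_vector_derivative of_real (- b * v powr (- b - 1))) (at v)"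
    using has_real_derivative_powr[OF assms, of "- b"] by (rule has_vector_derivative_of_real)
  have "v powr (- b - 1) = 1 / v powr (1 + b)"
    using assms by (simp add: powr_diff powr_minus powr_add field_simps)
  then show "(exp (- (z * of_real v)) - 1) * of_real (- b * v powr (- b - 1)) +
      - z * exp (- (z * of_real v)) * of_real (v powr (- b)) =
      (- z * (exp (- (z * of_real v)) * of_real (v powr (- b))) -
      of_real b * ((exp (- (z * of_real v)) - 1) / of_real (v powr (1 + b))))"
    by (simp add: algebra_simps)
qed

lemma tendsto_exp_minus_one_powr:
  assumes "0 < b" "b < 1" "Re z \<ge> 0"
  shows "((\<lambda>v. (exp (- (z * of_real v)) - 1) * of_real (v powr (- b))) \<longlongrightarrow> 0) (at_right 0)"
    and "((\<lambda>v. (exp (- (z * of_real v)) - 1) * of_real (v powr (- b))) \<longlongrightarrow> 0) at_top"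
proof -
  have bd: "norm ((exp (- (z * of_real v)) - 1) * of_real (v powr (- b))) \<le>
      (2 + norm z) * (v * powr_dom (- b) (- 1 - b) v)" if "v > 0" for v
  proof -
    have "(exp (- (z * of_real v)) - 1) * of_real (v powr (- b)) =
        of_real v * ((exp (- (z * of_real v)) - 1) / of_real (v powr (1 + b)))"
      using that by (simp add: powr_add powr_minus field_simps)
    then have "norm ((exp (- (z * of_real v)) - 1) * of_real (v powr (- b))) =
        v * norm ((exp (- (z * of_real v)) - 1) / of_real (v powr (1 + b)))"
      using that by (simp only: norm_mult norm_of_real abs_of_pos)
    also have "\<dots> \<le> v * ((2 + norm z) * powr_dom (- b) (- 1 - b) v)"
      using that assms by (intro mult_left_mono norm_exp_minus_one_powr_le) auto
    finally show ?thesis by (simp add: mult_ac)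
  qed
  show "((\<lambda>v. (exp (- (z * of_real v)) - 1) * of_real (v powr (- b))) \<longlongrightarrow> 0) (at_right 0)"
  proof (rule Lim_null_comparison)
    show "\<forall>\<^sub>F v in at_right 0. norm ((exp (- (z * of_real v)) - 1) * of_real (v powr (- b))) \<le>
      (2 + norm z) * (v * powr_dom (- b) (- 1 - b) v)"
      using bd by (auto simp: eventually_at_filter)
    show "((\<lambda>v. (2 + norm z) * (v * powr_dom (- b) (- 1 - b) v)) \<longlongrightarrow> 0) (at_right 0)"
      using assms by (intro tendsto_mult_right_zero tendsto_mult_powr_dom_0) auto
  qed
  show "((\<lambda>v. (exp (- (z * of_real v)) - 1) * of_real (v powr (- b))) \<longlongrightarrow> 0) at_top"
  proof (rule Lim_null_comparison)
    show "\<forall>\<^sub>F v in at_top. norm ((exp (- (z * of_real v)) - 1) * of_real (v powr (- b))) \<le>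
      (2 + norm z) * (v * powr_dom (- b) (- 1 - b) v)"
      using eventually_gt_at_top[of 0] by eventually_elim (rule bd)
    show "((\<lambda>v. (2 + norm z) * (v * powr_dom (- b) (- 1 - b) v)) \<longlongrightarrow> 0) at_top"
      using assms by (intro tendsto_mult_right_zero tendsto_mult_powr_dom_at_top) auto
  qed
qed

lemma Gamma_one_minus:
  assumes "0 < b" "b < (1::real)"
  shows "Gamma (1 - b) = - b * Gamma (- b)"
proof -
  have "- b \<notin> \<int>\<^sub>\<le>\<^sub>0"
  proof
    assume "- b \<in> \<int>\<^sub>\<le>\<^sub>0"
    then obtain n where "- b = of_int n"
      by (auto elim!: nonpos_Ints_cases)
    then have "real_of_int (-1) < of_int n" "real_of_int n < of_int 0"
      using assms by auto
    then show False
      unfolding of_int_less_iff by simp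
  qed
  then show ?thesis
    using Gamma_plus1[of "- b"] by simp
qed

text \<open>Since the boundary terms vanish, b times the integral is -z times the Laplace transform
  of v^{-b}, which is Gamma(1-b) z^{b-1}; then Gamma(1-b) = -b Gamma(-b). The condition Re z > 0
  makes that Laplace transform absolutely convergent.\<close>

lemma integral_exp_minus_one_powr_Re_pos:
  assumes "0 < b" "b < 1" "Re z > 0"
  shows "(LINT v:{0<..}|lborel. (exp (- (z * of_real v)) - 1) / of_real (v powr (1 + b))) =
    of_real (Gamma (- b)) * z powr of_real b"
proof -
  define I where "I = (LINT v:{0<..}|lborel. (exp (- (z * of_real v)) - 1) / of_real (v powr (1 + b)))"
  have i1: "set_integrable lborel {0<..} (\<lambda>v. exp (- (z * of_real v)) * of_real (v powr (- b)))"
    and I1: "(LINT v:{0<..}|lborel. exp (- (z * of_real v)) * of_real (v powr (- b))) =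
      of_real (Gamma (1 - b)) * z powr (of_real b - 1)"
    using integral_gamma_laplace[of "1 - b" z] assms by (auto simp: algebra_simps)
  have i2: "set_integrable lborel {0<..} (\<lambda>v. (exp (- (z * of_real v)) - 1) / of_real (v powr (1 + b)))"
    using assms by (intro set_integrable_exp_minus_one_powr) auto
  have i: "set_integrable lborel {0<..} (\<lambda>v. - z * (exp (- (z * of_real v)) * of_real (v powr (- b))) -
      of_real b * ((exp (- (z * of_real v)) - 1) / of_real (v powr (1 + b))))"
    by (intro set_integral_diff set_integrable_mult_right i1 i2)
  have "(LINT v:{0<..}|lborel. - z * (exp (- (z * of_real v)) * of_real (v powr (- b))) -
      of_real b * ((exp (- (z * of_real v)) - 1) / of_real (v powr (1 + b)))) = 0 - 0"
    by (rule integral_FTC_Ioi[OF has_vector_derivative_exp_minus_one_powr[of _ z b] _ i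
          tendsto_exp_minus_one_powr])
      (use assms in \<open>auto intro!: continuous_intros\<close>)
  also have "(LINT v:{0<..}|lborel. - z * (exp (- (z * of_real v)) * of_real (v powr (- b))) -
      of_real b * ((exp (- (z * of_real v)) - 1) / of_real (v powr (1 + b)))) =
      - z * (of_real (Gamma (1 - b)) * z powr (of_real b - 1)) - of_real b * I"
    unfolding I1[symmetric] I_def set_integral_mult_right[symmetric]
    by (rule set_integral_diff) (intro set_integrable_mult_right i1 i2)+
  finally have "of_real b * I = - z * (of_real (Gamma (1 - b)) * z powr (of_real b - 1))"
    by simp
  also have "Gamma (1 - b) = - b * Gamma (- b)"
    using assms by (intro Gamma_one_minus) auto
  also have "z powr (of_real b - 1) = z powr of_real b / z"
    using assms by (simp add: powr_diff)
  also have "- z * (of_real (- b * Gamma (- b)) * (z powr of_real b / z)) =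
      of_real b * (of_real (Gamma (- b)) * z powr of_real b)"
    using assms by auto
  finally show ?thesis
    using assms by (simp add: I_def)
qed

text \<open>On the imaginary axis e^{-ixv} v^{-b} is not absolutely integrable, so the previous
  argument does not apply there. The value is the limit along 1/(n+1) + ix; for x \<noteq> 0 the
  point ix is off the cut, where the power is continuous.\<close>

lemma integral_iexp_minus_one_powr:
  assumes "0 < b" "b < 1"
  shows "(LINT v:{0<..}|lborel. (iexp (- (x * v)) - 1) / of_real (v powr (1 + b))) =
    of_real (Gamma (- b)) * ipow b x"
proof (cases "x = 0")
  case True
  with assms show ?thesis by (simp add: ipow_def set_lebesgue_integral_def)
next
  case False
  define z where "z n = of_real (inverse (real (Suc n))) + \<i> * of_real x" for n
  have z: "z \<longlonglongrightarrow> \<i> * of_real x"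
    unfolding z_def by (rule tendsto_eq_intros LIMSEQ_inverse_real_of_nat tendsto_of_real refl)+ simp
  have nz: "norm (z n) \<le> 1 + \<bar>x\<bar>" for n
  proof -
    have "norm (complex_of_real (inverse (real (Suc n)))) \<le> 1"
      unfolding norm_of_real by (simp add: field_simps)
    then show ?thesis
      unfolding z_def by (intro order_trans[OF norm_triangle_ineq] add_mono) (auto simp: norm_mult)
  qed
  have ie: "exp (- (\<i> * of_real x * of_real v)) = iexp (- (x * v))" for v
    by (simp add: mult.assoc)
  have "(\<lambda>n. LINT v:{0<..}|lborel. (exp (- (z n * of_real v)) - 1) / of_real (v powr (1 + b)))
      \<longlonglongrightarrow> (LINT v:{0<..}|lborel. (exp (- (\<i> * of_real x * of_real v)) - 1) / of_real (v powr (1 + b)))"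
    unfolding set_lebesgue_integral_def
  proof (rule integral_dominated_convergence)
    \<comment> \<open>The factor \<open>3 + \<bar>x\<bar>\<close> is \<open>2 + norm (z n)\<close>
      with the bound \<open>1 + \<bar>x\<bar>\<close> inserted for the norm.\<close>
    show "integrable lborel (\<lambda>v. indicator {0<..} v *\<^sub>R ((3 + \<bar>x\<bar>) * powr_dom (- b) (- 1 - b) v))"
      using assms unfolding set_integrable_def[symmetric]
      by (intro set_integrable_mult_right set_integrable_powr_dom) auto
    show "AE v in lborel. (\<lambda>n. indicator {0<..} v *\<^sub>R ((exp (- (z n * of_real v)) - 1) / of_real (v powr (1 + b))))
        \<longlonglongrightarrow> indicator {0<..} v *\<^sub>R ((exp (- (\<i> * of_real x * of_real v)) - 1) / of_real (v powr (1 + b)))"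
      by (intro AE_I2) (auto simp: indicator_def intro!: tendsto_intros z)
    show "AE v in lborel. norm (indicator {0<..} v *\<^sub>R ((exp (- (z n * of_real v)) - 1) / of_real (v powr (1 + b))))
        \<le> indicator {0<..} v *\<^sub>R ((3 + \<bar>x\<bar>) * powr_dom (- b) (- 1 - b) v)" for n
    proof (rule AE_I2)
      fix v :: real
      have "norm ((exp (- (z n * of_real v)) - 1) / of_real (v powr (1 + b))) \<le>
          (3 + \<bar>x\<bar>) * powr_dom (- b) (- 1 - b) v" if "v > 0"
      proof -
        have "norm ((exp (- (z n * of_real v)) - 1) / of_real (v powr (1 + b))) \<le>
            (2 + norm (z n)) * powr_dom (- b) (- 1 - b) v"
          using that by (intro norm_exp_minus_one_powr_le) (auto simp: z_def)
        also have "\<dots> \<le> (3 + \<bar>x\<bar>) * powr_dom (- b) (- 1 - b) v"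
          using nz[of n] by (intro mult_right_mono) auto
        finally show ?thesis .
      qed
      then show "norm (indicator {0<..} v *\<^sub>R ((exp (- (z n * of_real v)) - 1) / of_real (v powr (1 + b))))
        \<le> indicator {0<..} v *\<^sub>R ((3 + \<bar>x\<bar>) * powr_dom (- b) (- 1 - b) v)"
        by (auto simp: indicator_def)
    qed
  qed auto
  moreover have "(LINT v:{0<..}|lborel. (exp (- (z n * of_real v)) - 1) / of_real (v powr (1 + b))) =
      of_real (Gamma (- b)) * z n powr of_real b" for n
    using assms by (intro integral_exp_minus_one_powr_Re_pos) (auto simp: z_def)
  moreover have "(\<lambda>n. of_real (Gamma (- b)) * z n powr of_real b) \<longlonglongrightarrow>
      of_real (Gamma (- b)) * (\<i> * of_real x) powr of_real b"
    using False by (intro tendsto_intros z tendsto_powr_complex) (auto simp: complex_nonpos_Reals_iff)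
  ultimately have "(LINT v:{0<..}|lborel. (exp (- (\<i> * of_real x * of_real v)) - 1) / of_real (v powr (1 + b))) =
      of_real (Gamma (- b)) * (\<i> * of_real x) powr of_real b"
    by (simp only: LIMSEQ_unique)
  then show ?thesis
    using False unfolding ie by (simp add: ipow_def)
qed

lemma set_integrable_iexp_minus_one_powr:
  assumes "0 < b" "b < 1"
  shows "set_integrable lborel {0<..} (\<lambda>v. (iexp (- (x * v)) - 1) / of_real (v powr (1 + b)))"
  using set_integrable_exp_minus_one_powr[OF assms, of "\<i> * of_real x"] by (simp add: mult.assoc)

text \<open>Substituting |x| v for v, the denominator contributes |x|^{1+b} and the differential
  1/|x|; the constant is the value at x = 1. Negative x is reduced to positive x by conjugation,
  which preserves moduli.\<close>

lemma integral_norm_iexp_minus_one_powr: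
  assumes "0 < b" "b < 1"
  obtains C where "C \<ge> 0" and "\<And>x. (LINT v:{0<..}|lborel. norm ((iexp (- (x * v)) - 1) / of_real (v powr (1 + b)))) \<le> C * \<bar>x\<bar> powr b"
proof -
  define k where "k x v = norm ((iexp (- (x * v)) - 1) / of_real (v powr (1 + b)))" for x v :: real
  define C where "C = (LINT v:{0<..}|lborel. k 1 v)"
  have "C \<ge> 0"
    unfolding C_def set_lebesgue_integral_def by (rule integral_nonneg_AE) (auto simp: k_def)
  moreover have "(LINT v:{0<..}|lborel. k x v) \<le> C * \<bar>x\<bar> powr b" for x
  proof (cases "x = 0")
    case True
    then show ?thesis by (simp add: k_def set_lebesgue_integral_def)
  next
    case False
    have kk: "k x v = \<bar>x\<bar> powr (1 + b) * k 1 (\<bar>x\<bar> * v)" if "v > 0" for v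
    proof -
      have "norm (iexp (- (x * v)) - 1) = norm (iexp (- (\<bar>x\<bar> * v)) - 1)"
      proof (cases "x > 0")
        case False
        have "iexp (- (\<bar>x\<bar> * v)) - 1 = cnj (iexp (- (x * v)) - 1)"
          using False by (simp add: exp_cnj)
        then show ?thesis by (simp only: complex_mod_cnj)
      qed simp
      then show ?thesis
        using that False by (simp add: k_def norm_divide powr_mult del: of_real_mult)
    qed
    have "(LINT v:{0<..}|lborel. k x v) = (LINT v:{0<..}|lborel. \<bar>x\<bar> powr (1 + b) * k 1 (\<bar>x\<bar> * v))"
      by (rule set_lebesgue_integral_cong) (auto simp: kk)
    also have "\<dots> = \<bar>x\<bar> powr (1 + b) * (C /\<^sub>R \<bar>x\<bar>)"
      using False by (simp add: integral_Ioi_scale C_def)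
    also have "\<dots> = C * \<bar>x\<bar> powr b"
      using False by (simp add: powr_add)
    finally show ?thesis by simp
  qed
  ultimately show ?thesis
    using that unfolding k_def by blast
qed

subsection \<open>Truncated oscillatory integrals\<close>

lemma set_integral_Ioo_tendsto_Ioi:
  fixes g :: "real \<Rightarrow> complex"
  assumes "set_integrable lborel {0<..} g"
  shows "((\<lambda>T. LINT v:{0<..<T}|lborel. g v) \<longlongrightarrow> (LINT v:{0<..}|lborel. g v)) at_top"
  unfolding set_lebesgue_integral_def
proof (rule integral_dominated_convergence_at_top)
  have "integrable lborel (\<lambda>v. indicator {0<..} v *\<^sub>R g v)"
    using assms by (simp add: set_integrable_def)
  then show "integrable lborel (\<lambda>v. norm (indicator {0<..} v *\<^sub>R g v))"
    and m: "(\<lambda>v. indicator {0<..} v *\<^sub>R g v) \<in> borel_measurable lborel"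
    by (auto dest: borel_measurable_integrable simp del: norm_scaleR)
  show "(\<lambda>v. indicator {0<..<T} v *\<^sub>R g v) \<in> borel_measurable lborel" for T
  proof -
    have "(\<lambda>v. indicator {0<..<T} v *\<^sub>R g v) = (\<lambda>v. indicator {..<T} v *\<^sub>R (indicator {0<..} v *\<^sub>R g v))"
      by (auto simp: indicator_def fun_eq_iff)
    then show ?thesis
      by (simp only:) (intro borel_measurable_scaleR m, simp)
  qed
  show "\<forall>\<^sub>F T in at_top. AE v in lborel. norm (indicator {0<..<T} v *\<^sub>R g v) \<le> norm (indicator {0<..} v *\<^sub>R g v)"
    by (intro always_eventually allI AE_I2) (auto simp: indicator_def)
  show "AE v in lborel. ((\<lambda>T. indicator {0<..<T} v *\<^sub>R g v) \<longlongrightarrow> indicator {0<..} v *\<^sub>R g v) at_top"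
  proof (intro AE_I2 tendsto_eventually)
    show "\<forall>\<^sub>F T in at_top. indicator {0<..<T} v *\<^sub>R g v = indicator {0<..} v *\<^sub>R g v" for v
      using eventually_gt_at_top[of v] by eventually_elim (auto simp: indicator_def)
  qed
qed

lemma set_integrable_iexp_powr:
  assumes "-1 < s" "s < 0"
  shows "set_integrable lborel {0<..<T} (\<lambda>v. iexp (- (x * v)) / of_real (v powr (1 + s)))"
proof -
  have "set_integrable lborel {0<..<T} (\<lambda>v. v powr (- (1 + s)))"
    by (rule set_integrable_subset[OF set_integrable_powr_Ioc[of "- (1 + s)" T]]) (use assms in auto)
  then show ?thesis
    unfolding powr_minus_divide
    by (rule set_integrable_bound) (auto simp: norm_divide set_borel_measurable_def)
qed

text \<open>Subtracting 1 in the antiderivative (e^{-ixv} - 1) v^{-(1+s)} makes its limit at 0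
  vanish. A conditionally convergent integral is traded for the regularized one of order b = 1 + s,
  which converges absolutely, and a boundary term at T.\<close>

lemma integral_iexp_powr_by_parts:
  assumes "-1 < s" "s < 0" "T > 0"
  shows "\<i> * of_real x * (LINT v:{0<..<T}|lborel. iexp (- (x * v)) / of_real (v powr (1 + s))) =
    - of_real (1 + s) * (LINT v:{0<..<T}|lborel. (iexp (- (x * v)) - 1) / of_real (v powr (1 + (1 + s))))
    - (iexp (- (x * T)) - 1) * of_real (T powr (- (1 + s)))"
proof -
  define z where "z = \<i> * of_real x"
  have e: "iexp (- (x * v)) = exp (- (z * of_real v))" for v
    by (simp add: z_def mult.assoc)
  have d: "exp (- (z * of_real v)) / of_real (v powr (1 + s)) =
      exp (- (z * of_real v)) * of_real (v powr (- (1 + s)))" for v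
    by (simp only: powr_minus divide_inverse of_real_inverse)
  have i1: "set_integrable lborel {0<..<T} (\<lambda>v. exp (- (z * of_real v)) * of_real (v powr (- (1 + s))))"
    using set_integrable_iexp_powr[OF assms(1,2), of T x] unfolding e d .
  have i2: "set_integrable lborel {0<..<T} (\<lambda>v. (exp (- (z * of_real v)) - 1) / of_real (v powr (1 + (1 + s))))"
    using assms by (intro set_integrable_subset[OF set_integrable_exp_minus_one_powr]) (auto simp: z_def)
  have i: "set_integrable lborel {0<..<T} (\<lambda>v. - z * (exp (- (z * of_real v)) * of_real (v powr (- (1 + s)))) -
      of_real (1 + s) * ((exp (- (z * of_real v)) - 1) / of_real (v powr (1 + (1 + s)))))"
    by (intro set_integral_diff set_integrable_mult_right i1 i2)
  have "(LINT v:{0<..<T}|lborel. - z * (exp (- (z * of_real v)) * of_real (v powr (- (1 + s)))) -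
      of_real (1 + s) * ((exp (- (z * of_real v)) - 1) / of_real (v powr (1 + (1 + s))))) =
      (exp (- (z * of_real T)) - 1) * of_real (T powr (- (1 + s))) - 0"
    by (rule integral_FTC_Ioo[OF assms(3) has_vector_derivative_exp_minus_one_powr[of _ z "1 + s"] _ i
          tendsto_exp_minus_one_powr(1)])
      (use assms in \<open>auto intro!: continuous_intros simp: z_def\<close>)
  also have "(LINT v:{0<..<T}|lborel. - z * (exp (- (z * of_real v)) * of_real (v powr (- (1 + s)))) -
      of_real (1 + s) * ((exp (- (z * of_real v)) - 1) / of_real (v powr (1 + (1 + s))))) =
      - z * (LINT v:{0<..<T}|lborel. exp (- (z * of_real v)) * of_real (v powr (- (1 + s))))
      - of_real (1 + s) * (LINT v:{0<..<T}|lborel. (exp (- (z * of_real v)) - 1) / of_real (v powr (1 + (1 + s))))"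
    unfolding set_integral_mult_right[symmetric]
    by (rule set_integral_diff) (intro set_integrable_mult_right i1 i2)+
  finally show ?thesis
    unfolding e d z_def[symmetric] by (simp add: algebra_simps)
qed

text \<open>Uniformity in \<open>T\<close> is the point: this is the majorant that carries T to
  infinity under the expectation. Both terms of the integration by parts are of size |x|^{1+s}, and
  division by |x| gives the bound.\<close>

lemma norm_integral_iexp_powr_le:
  assumes "-1 < s" "s < 0"
  obtains C where "\<And>x T. x \<noteq> 0 \<Longrightarrow> T > 0 \<Longrightarrow>
    norm (LINT v:{0<..<T}|lborel. iexp (- (x * v)) / of_real (v powr (1 + s))) \<le> C * \<bar>x\<bar> powr s"
proof -
  from assms have b: "0 < 1 + s" "1 + s < 1" by auto
  obtain C where C: "C \<ge> 0" "\<And>x. (LINT v:{0<..}|lborel. norm ((iexp (- (x * v)) - 1) / of_real (v powr (1 + (1 + s))))) \<le> C * \<bar>x\<bar> powr (1 + s)"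
  proof (rule integral_norm_iexp_minus_one_powr[OF b], goal_cases)
    case (1 C)
    show thesis by (rule 1(1)[OF 1(2,3)])
  qed
  have "norm (LINT v:{0<..<T}|lborel. iexp (- (x * v)) / of_real (v powr (1 + s))) \<le> (C + 2) * \<bar>x\<bar> powr s"
    if "x \<noteq> 0" "T > 0" for x T
  proof -
    let ?k = "\<lambda>v. (iexp (- (x * v)) - 1) / of_real (v powr (1 + (1 + s)))"
    have i: "set_integrable lborel {0<..} ?k"
      using set_integrable_iexp_minus_one_powr[OF b] .
    have "norm (LINT v:{0<..<T}|lborel. ?k v) \<le> (LINT v:{0<..<T}|lborel. norm (?k v))"
      by (rule set_integral_norm_bound, rule set_integrable_subset[OF i]) auto
    also have "\<dots> \<le> (LINT v:{0<..}|lborel. norm (?k v))"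
    proof -
      have "integrable lborel (\<lambda>v. indicator {0<..<T} v *\<^sub>R norm (?k v))"
        unfolding set_integrable_def[symmetric]
        by (rule set_integrable_subset[OF set_integrable_norm[OF i]]) auto
      then show ?thesis
        using set_integrable_norm[OF i] unfolding set_lebesgue_integral_def set_integrable_def
        by (intro integral_mono) (auto simp: indicator_def)
    qed
    also have "\<dots> \<le> C * \<bar>x\<bar> powr (1 + s)"
      by (rule C(2))
    finally have 1: "norm (LINT v:{0<..<T}|lborel. ?k v) \<le> C * \<bar>x\<bar> powr (1 + s)" .
    \<comment> \<open>Interpolation between the bounds |x|T and 2, possible since 0 < 1 + s < 1. The
      exponent is chosen so that T cancels against the factor T^{-(1+s)}.\<close>
    have m: "norm (iexp (- (x * T)) - 1) \<le> 2 * (\<bar>x\<bar> * T) powr (1 + s)"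
    proof (cases "\<bar>x\<bar> * T \<le> 1")
      case True
      have "norm (iexp (- (x * T)) - 1) \<le> \<bar>x\<bar> * T"
        using iexp_approx1[of "- (x * T)" 0] that by (simp add: abs_mult)
      also have "\<dots> = (\<bar>x\<bar> * T) powr 1"
        using that by simp
      also have "\<dots> \<le> (\<bar>x\<bar> * T) powr (1 + s)"
        using True assms that by (intro powr_mono') auto
      finally show ?thesis
        using powr_ge_zero[of "\<bar>x\<bar> * T" "1 + s"] by linarith
    next
      case False
      have "norm (iexp (- (x * T)) - 1) \<le> 2"
        using iexp_approx2[of "- (x * T)" 0] by simp
      moreover have "1 \<le> (\<bar>x\<bar> * T) powr (1 + s)"
        using False b by (intro ge_one_powr_ge_zero) auto
      ultimately show ?thesis by simp
    qed
    have "norm ((iexp (- (x * T)) - 1) * of_real (T powr (- (1 + s)))) =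
        norm (iexp (- (x * T)) - 1) * T powr (- (1 + s))"
      by (simp only: norm_mult norm_of_real) simp
    also have "\<dots> \<le> 2 * (\<bar>x\<bar> * T) powr (1 + s) * T powr (- (1 + s))"
      using m by (rule mult_right_mono) simp
    also have "\<dots> = 2 * \<bar>x\<bar> powr (1 + s)"
      using that by (simp add: powr_mult mult.assoc flip: powr_add)
    finally have 2: "norm ((iexp (- (x * T)) - 1) * of_real (T powr (- (1 + s)))) \<le> 2 * \<bar>x\<bar> powr (1 + s)" .
    have "\<bar>x\<bar> * norm (LINT v:{0<..<T}|lborel. iexp (- (x * v)) / of_real (v powr (1 + s))) =
        norm (\<i> * of_real x * (LINT v:{0<..<T}|lborel. iexp (- (x * v)) / of_real (v powr (1 + s))))"
      by (simp add: norm_mult)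
    also have "\<dots> \<le> norm (of_real (1 + s) * (LINT v:{0<..<T}|lborel. ?k v)) +
        norm ((iexp (- (x * T)) - 1) * of_real (T powr (- (1 + s))))"
      unfolding integral_iexp_powr_by_parts[OF assms that(2)] mult_minus_left
      by (rule order_trans[OF norm_triangle_ineq4]) simp
    also have "\<dots> \<le> C * \<bar>x\<bar> powr (1 + s) + 2 * \<bar>x\<bar> powr (1 + s)"
    proof (rule add_mono[OF _ 2])
      have "norm (of_real (1 + s) * (LINT v:{0<..<T}|lborel. ?k v)) =
          (1 + s) * norm (LINT v:{0<..<T}|lborel. ?k v)"
        using b by (simp only: norm_mult norm_of_real abs_of_pos)
      also have "\<dots> \<le> 1 * norm (LINT v:{0<..<T}|lborel. ?k v)"
        using b by (intro mult_right_mono) auto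
      finally show "norm (of_real (1 + s) * (LINT v:{0<..<T}|lborel. ?k v)) \<le> C * \<bar>x\<bar> powr (1 + s)"
        using 1 by simp
    qed
    also have "\<dots> = \<bar>x\<bar> * ((C + 2) * \<bar>x\<bar> powr s)"
      using that by (simp add: powr_add algebra_simps)
    finally show ?thesis
      using that by simp
  qed
  then show thesis by (rule that)
qed

text \<open>The identity by parts is divided by ix, hence x \<noteq> 0. As T grows the boundary term
  disappears, and Gamma(-s) = -(1+s) Gamma(-(1+s)) absorbs the remaining factor.\<close>

lemma integral_iexp_powr_tendsto:
  assumes "-1 < s" "s < 0" "x \<noteq> 0"
  shows "((\<lambda>T. LINT v:{0<..<T}|lborel. iexp (- (x * v)) / of_real (v powr (1 + s)))
    \<longlongrightarrow> of_real (Gamma (- s)) * ipow s x) at_top"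
proof -
  have b: "0 < 1 + s" "1 + s < 1" using assms by auto
  let ?I = "\<lambda>T. LINT v:{0<..<T}|lborel. (iexp (- (x * v)) - 1) / of_real (v powr (1 + (1 + s)))"
  let ?b = "\<lambda>T. (iexp (- (x * T)) - 1) * of_real (T powr (- (1 + s)))"
  have 1: "(?I \<longlongrightarrow> of_real (Gamma (- (1 + s))) * ipow (1 + s) x) at_top"
    using set_integral_Ioo_tendsto_Ioi[OF set_integrable_iexp_minus_one_powr[OF b, of x]]
    unfolding integral_iexp_minus_one_powr[OF b] .
  have 2: "(?b \<longlongrightarrow> 0) at_top"
    using tendsto_exp_minus_one_powr(2)[OF b, of "\<i> * of_real x"] by (simp add: mult.assoc)
  have "((\<lambda>T. (- of_real (1 + s) * ?I T - ?b T) / (\<i> * of_real x)) \<longlongrightarrow>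
      (- of_real (1 + s) * (of_real (Gamma (- (1 + s))) * ipow (1 + s) x) - 0) / (\<i> * of_real x)) at_top"
    by (intro tendsto_divide tendsto_diff tendsto_mult 1 2 tendsto_const) (use assms in auto)
  also have "(- of_real (1 + s) * (of_real (Gamma (- (1 + s))) * ipow (1 + s) x) - 0) / (\<i> * of_real x) =
      of_real (Gamma (- s)) * ipow s x"
  proof -
    have 1: "ipow (1 + s) x = \<i> * of_real x * ipow s x"
      using ipow_add[OF assms(3), of 1 s] ipow_of_nat[of 1 x] by simp
    have 2: "Gamma (- s) = - (1 + s) * Gamma (- (1 + s))"
      using Gamma_one_minus[OF b] by simp
    show ?thesis
      unfolding 1 2 using assms(3) by simp
  qed
  finally show ?thesis
  proof (rule Lim_transform_eventually)
    show "\<forall>\<^sub>F T in at_top. (- of_real (1 + s) * ?I T - ?b T) / (\<i> * of_real x) =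
      (LINT v:{0<..<T}|lborel. iexp (- (x * v)) / of_real (v powr (1 + s)))"
      using eventually_gt_at_top[of 0]
    proof eventually_elim
      case (elim T)
      show ?case
        unfolding integral_iexp_powr_by_parts[OF assms(1,2) elim, symmetric] using assms(3) by simp
    qed
  qed
qed

subsection \<open>Remainders of the exponential series\<close>

definition iexp_rem :: "nat \<Rightarrow> real \<Rightarrow> complex" where
  "iexp_rem m x = iexp x - (\<Sum>k\<le>m. (\<i> * of_real x) ^ k / fact k)"

text \<open>The integrand of K(x) in polar form: for t > 0 the two phases times
  \<open>t powr (- p - 1)\<close> are (it)^{-p-1} and (-it)^{-p-1}.\<close>

definition rem_kernel :: "real \<Rightarrow> real \<Rightarrow> real \<Rightarrow> complex" where
  "rem_kernel p x t =
    (cis (- (pi * (p + 1) / 2)) * iexp_rem (nat \<lceil>p - 1\<rceil>) (x * t) +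
     cis (pi * (p + 1) / 2) * iexp_rem (nat \<lceil>p - 1\<rceil>) (- (x * t))) * of_real (t powr (- p - 1))"

text \<open>Factorials are dropped, as only the orders matter: degree m + 1 is used near 0 and
  degree m at infinity.\<close>

lemma norm_iexp_rem_le:
  shows "norm (iexp_rem m x) \<le> \<bar>x\<bar> ^ Suc m" and "norm (iexp_rem m x) \<le> 2 * \<bar>x\<bar> ^ m"
proof -
  have "\<bar>x\<bar> ^ n / fact n \<le> \<bar>x\<bar> ^ n" for n
    using mult_left_mono[OF fact_ge_1[where 'a = real, of n], of "\<bar>x\<bar> ^ n"]
    by (simp add: divide_le_eq)
  from this[of "Suc m"] this[of m] show "norm (iexp_rem m x) \<le> \<bar>x\<bar> ^ Suc m" "norm (iexp_rem m x) \<le> 2 * \<bar>x\<bar> ^ m"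
    using iexp_approx1[of x m] iexp_approx2[of x m] unfolding iexp_rem_def by linarith+
qed

lemma iexp_rem_Suc: "iexp_rem m x = (\<i> * of_real x) ^ Suc m / fact (Suc m) + iexp_rem (Suc m) x"
  by (simp add: iexp_rem_def)

text \<open>Differentiation shortens the partial sum of the exponential series by one term; this is
  what lets integration by parts lower \<open>p\<close> by one.\<close>

lemma has_vector_derivative_iexp_rem:
  "((\<lambda>t. iexp_rem (Suc m) (x * t)) has_vector_derivative \<i> * of_real x * iexp_rem m (x * t)) (at t)"
proof -
  define z where "z = \<i> * of_real x"
  have eq: "iexp_rem n (x * t) = exp (z * of_real t) - (\<Sum>k\<le>n. (z * of_real t) ^ k / fact k)" for n t
    by (simp add: iexp_rem_def z_def mult.assoc)
  have s: "((\<lambda>w. \<Sum>k\<le>n. (z * w) ^ k / fact k) has_field_derivative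
      z * (\<Sum>k<n. (z * w) ^ k / fact k)) (at w)" for n w
  proof (induction n)
    case (Suc n)
    have "((\<lambda>w. (z * w) ^ Suc n / fact (Suc n)) has_field_derivative
        (of_nat (Suc n) * (z * w) ^ n * z) / fact (Suc n)) (at w)"
      by (rule DERIV_cdivide, rule DERIV_cong[OF DERIV_power_Suc]) (auto intro!: derivative_eq_intros)
    also have "(of_nat (Suc n) * (z * w) ^ n * z) / fact (Suc n) = z * ((z * w) ^ n / fact n)"
      by (simp add: fact_Suc del: of_nat_Suc)
    finally have "((\<lambda>w. (z * w) ^ Suc n / fact (Suc n)) has_field_derivative z * ((z * w) ^ n / fact n)) (at w)" .
    from DERIV_add[OF Suc.IH this] show ?case
      by (simp add: distrib_left)
  qed simp
  have "((\<lambda>w. exp (z * w) - (\<Sum>k\<le>Suc m. (z * w) ^ k / fact k)) has_field_derivative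
      exp (z * of_real t) * z - z * (\<Sum>k<Suc m. (z * of_real t) ^ k / fact k)) (at (of_real t))"
    by (intro DERIV_diff s) (auto intro!: derivative_eq_intros)
  from has_vector_derivative_real_field[OF this]
  show ?thesis
    unfolding eq by (simp add: lessThan_Suc_atMost algebra_simps flip: z_def)
qed

lemma has_vector_derivative_iexp_rem_neg:
  "((\<lambda>t. iexp_rem (Suc m) (- (x * t))) has_vector_derivative - \<i> * of_real x * iexp_rem m (- (x * t))) (at t)"
  using has_vector_derivative_iexp_rem[of m "- x" t] by simp

lemma continuous_iexp_rem [continuous_intros]:
  "continuous_on A g \<Longrightarrow> continuous_on A (\<lambda>t. iexp_rem m (g t))"
  unfolding iexp_rem_def by (intro continuous_intros) auto

lemma iexp_rem_measurable [measurable]: "iexp_rem m \<in> borel_measurable borel"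
  by (intro borel_measurable_continuous_onI continuous_intros)

text \<open>With l the Taylor degree, l < p gives integrability at infinity and p < l + 1 gives it
  at 0. The borderline p = l + 1 is the case of natural p, which depends on a cancellation.\<close>

lemma nat_ceiling_minus_1:
  assumes "p > 0"
  shows "p \<le> real (nat \<lceil>p - 1\<rceil>) + 1" "real (nat \<lceil>p - 1\<rceil>) < p"
    and "p \<notin> \<nat> \<Longrightarrow> p < real (nat \<lceil>p - 1\<rceil>) + 1"
    and "p \<in> \<nat> \<Longrightarrow> p = real (nat \<lceil>p - 1\<rceil>) + 1"
proof -
  have c: "\<lceil>p - 1\<rceil> \<ge> 0"
    using assms by linarith
  then have e: "real (nat \<lceil>p - 1\<rceil>) = of_int \<lceil>p - 1\<rceil>"
    by simp
  show 1: "p \<le> real (nat \<lceil>p - 1\<rceil>) + 1" and "real (nat \<lceil>p - 1\<rceil>) < p"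
    unfolding e by linarith+
  show "p < real (nat \<lceil>p - 1\<rceil>) + 1" if "p \<notin> \<nat>"
  proof (rule ccontr)
    assume "\<not> p < real (nat \<lceil>p - 1\<rceil>) + 1"
    then have "p = real (nat \<lceil>p - 1\<rceil> + 1)"
      using 1 by (simp only: of_nat_add of_nat_1)
    then show False
      using that of_nat_in_Nats by metis
  qed
  show "p = real (nat \<lceil>p - 1\<rceil>) + 1" if "p \<in> \<nat>"
    using that assms by (auto elim!: Nats_cases)
qed

lemma ii_power_cis: "\<i> ^ n = cis (pi * real n / 2)" "(- \<i>) ^ n = cis (- (pi * real n / 2))"
proof -
  have "\<i> ^ n = cis (pi / 2) ^ n" by simp
  also have "\<dots> = cis (pi * real n / 2)"
    by (simp only: Complex.DeMoivre) (simp add: mult.commute)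
  finally show "\<i> ^ n = cis (pi * real n / 2)" .
  have "(- \<i>) ^ n = cis (- (pi / 2)) ^ n" by simp
  also have "\<dots> = cis (- (pi * real n / 2))"
    by (simp only: Complex.DeMoivre) (simp add: mult.commute)
  finally show "(- \<i>) ^ n = cis (- (pi * real n / 2))" .
qed

text \<open>For integer \<open>p\<close> the two leading terms, of order \<open>t\<^sup>p\<close>, cancel; separately they would give
  divergent integrals.\<close>

lemma rem_kernel_of_nat:
  assumes "p > 0" "p \<in> \<nat>"
  shows "rem_kernel p x t =
    (cis (- (pi * (p + 1) / 2)) * iexp_rem (Suc (nat \<lceil>p - 1\<rceil>)) (x * t) +
     cis (pi * (p + 1) / 2) * iexp_rem (Suc (nat \<lceil>p - 1\<rceil>)) (- (x * t))) * of_real (t powr (- p - 1))"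
proof -
  define n where "n = Suc (nat \<lceil>p - 1\<rceil>)"
  have p: "p = real n"
    using nat_ceiling_minus_1(4)[OF assms] by (simp only: n_def of_nat_Suc add.commute)
  have "cis (- (pi * (p + 1) / 2)) * (\<i> * of_real (x * t)) ^ n +
      cis (pi * (p + 1) / 2) * (\<i> * of_real (- (x * t))) ^ n = 
      of_real (x * t) ^ n * (cis (- (pi * (p + 1) / 2)) * \<i> ^ n + cis (pi * (p + 1) / 2) * (- \<i>) ^ n)"
  proof -
    have "\<i> * of_real y = of_real y * \<i>" "\<i> * of_real (- y) = of_real y * (- \<i>)" for y
      by simp_all
    then show ?thesis
      by (simp only: power_mult_distrib) (simp only: distrib_left mult_ac)
  qed
  also have "cis (- (pi * (p + 1) / 2)) * \<i> ^ n + cis (pi * (p + 1) / 2) * (- \<i>) ^ n =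
      cis (- (pi / 2)) + cis (pi / 2)"
    unfolding ii_power_cis cis_mult p by (simp add: field_simps)
  also have "\<dots> = 0"
    by (simp add: complex_eq_iff)
  finally have z: "cis (- (pi * (p + 1) / 2)) * ((\<i> * of_real (x * t)) ^ n / fact n) +
      cis (pi * (p + 1) / 2) * ((\<i> * of_real (- (x * t))) ^ n / fact n) = 0"
    by (simp flip: add_divide_distrib)
  have split: "c * (A + B) + c' * (A' + B') = c * A + c' * A' + (c * B + c' * B')" for c c' A A' B B' :: complex
    by (simp add: algebra_simps)
  show ?thesis
    unfolding rem_kernel_def iexp_rem_Suc[of "nat \<lceil>p - 1\<rceil>"] n_def[symmetric] split z by simp
qed

lemma norm_rem_kernel_le:
  assumes "p > 0"
  obtains a b where "a > -1" "b < -1"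
    "\<And>x t. \<bar>x\<bar> = 1 \<Longrightarrow> t > 0 \<Longrightarrow> norm (rem_kernel p x t) \<le> 4 * powr_dom a b t"
proof -
  define l where "l = nat \<lceil>p - 1\<rceil>"
  note l = nat_ceiling_minus_1[OF assms, folded l_def]
  \<comment> \<open>Near 0 the remainder has order l + 1, so the exponent is l - p > -1 unless p is
    natural. For natural p, where l - p = -1, the cancellation raises the order to l + 2 and the
    exponent to 0.\<close>
  define a where "a = (if p \<in> \<nat> then 0 else real l - p)"
  \<comment> \<open>At infinity the remainder grows at most like t^l.\<close>
  define b where "b = real l - p - 1"
  have main: "norm ((cis (- (pi * (p + 1) / 2)) * iexp_rem m (x * t) +
     cis (pi * (p + 1) / 2) * iexp_rem m (- (x * t))) * of_real (t powr (- p - 1))) \<le>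
     2 * c * t powr (- p - 1)"
    if "norm (iexp_rem m (x * t)) \<le> c" "norm (iexp_rem m (- (x * t))) \<le> c" for m x t c
  proof -
    have "c \<ge> 0"
      using that(1) norm_ge_zero order_trans by blast
    then show ?thesis
      unfolding norm_mult norm_of_real using that
      by (intro mult_mono order_trans[OF norm_triangle_ineq]) (auto simp: norm_mult)
  qed
  have "norm (rem_kernel p x t) \<le> 4 * powr_dom a b t" if x: "\<bar>x\<bar> = 1" and t: "t > 0" for x t
  proof (cases "t \<le> 1")
    case True
    have "norm (rem_kernel p x t) \<le> 2 * t powr a"
    proof (cases "p \<in> \<nat>")
      case True
      have "norm (rem_kernel p x t) \<le> 2 * t ^ (l + 2) * t powr (- p - 1)"
        unfolding rem_kernel_of_nat[OF assms True] l_def[symmetric]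
        using norm_iexp_rem_le(1)[of "Suc l" "x * t"] norm_iexp_rem_le(1)[of "Suc l" "- (x * t)"] x t
        by (intro main) (auto simp: abs_mult)
      also have "\<dots> = 2 * t powr (real (l + 2) + (- p - 1))"
        using t by (simp only: powr_add powr_realpow mult.assoc)
      also have "real (l + 2) + (- p - 1) = 0"
        using l(4)[OF True] by simp
      finally show ?thesis using True by (simp add: a_def)
    next
      case False
      have "norm (rem_kernel p x t) \<le> 2 * t ^ (l + 1) * t powr (- p - 1)"
        unfolding rem_kernel_def l_def[symmetric]
        using norm_iexp_rem_le(1)[of l "x * t"] norm_iexp_rem_le(1)[of l "- (x * t)"] x t
        by (intro main) (auto simp: abs_mult)
      also have "\<dots> = 2 * t powr (real (l + 1) + (- p - 1))"
        using t by (simp only: powr_add powr_realpow mult.assoc)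
      finally show ?thesis using False by (simp add: a_def)
    qed
    also have "\<dots> \<le> 4 * t powr a" by simp
    finally show ?thesis using True by (simp add: powr_dom_def)
  next
    case False
    have "norm (rem_kernel p x t) \<le> 2 * (2 * t ^ l) * t powr (- p - 1)"
      unfolding rem_kernel_def l_def[symmetric]
      using norm_iexp_rem_le(2)[of l "x * t"] norm_iexp_rem_le(2)[of l "- (x * t)"] x t
      by (intro main) (auto simp: abs_mult)
    also have "\<dots> = 4 * t powr (real l + (- p - 1))"
      using t by (simp only: powr_add powr_realpow)
    also have "real l + (- p - 1) = b"
      by (simp add: b_def)
    finally show ?thesis using False by (simp add: powr_dom_def)
  qed
  moreover have "a > -1" "b < -1"
    using l by (auto simp: a_def b_def)
  ultimately show thesis
    by (intro that)
qed

lemma continuous_on_rem_kernel: "continuous_on {0<..} (rem_kernel p x)"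
  unfolding rem_kernel_def by (intro continuous_intros) auto

lemma set_integrable_rem_kernel_unit:
  assumes "p > 0" "\<bar>x\<bar> = 1"
  shows "set_integrable lborel {0<..} (rem_kernel p x)"
proof -
  obtain a b where "a > -1" "b < -1"
    "\<And>x t. \<bar>x\<bar> = 1 \<Longrightarrow> t > 0 \<Longrightarrow> norm (rem_kernel p x t) \<le> 4 * powr_dom a b t"
    using norm_rem_kernel_le[OF assms(1)] by blast
  then show ?thesis
    using assms(2) by (intro set_integrable_Ioi_bound[OF continuous_on_rem_kernel]) auto
qed

text \<open>The function t times the kernel is the antiderivative behind the recurrence in
  \<open>p\<close>; its boundary values vanish by the bound that gives integrability.\<close>

lemma tendsto_mult_rem_kernel:
  assumes "p > 0" "\<bar>x\<bar> = 1"
  shows "((\<lambda>t. of_real t * rem_kernel p x t) \<longlongrightarrow> 0) (at_right 0)"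
    and "((\<lambda>t. of_real t * rem_kernel p x t) \<longlongrightarrow> 0) at_top"
proof -
  obtain a b where ab: "a > -1" "b < -1"
    and le: "\<And>x t. \<bar>x\<bar> = 1 \<Longrightarrow> t > 0 \<Longrightarrow> norm (rem_kernel p x t) \<le> 4 * powr_dom a b t"
    using norm_rem_kernel_le[OF assms(1)] by blast
  have bd: "norm (of_real t * rem_kernel p x t) \<le> 4 * (t * powr_dom a b t)" if "t > 0" for t
    using mult_left_mono[OF le[OF assms(2) that], of t] that by (simp add: norm_mult)
  show "((\<lambda>t. of_real t * rem_kernel p x t) \<longlongrightarrow> 0) (at_right 0)"
  proof (rule Lim_null_comparison)
    show "\<forall>\<^sub>F t in at_right 0. norm (of_real t * rem_kernel p x t) \<le> 4 * (t * powr_dom a b t)"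
      using bd by (auto simp: eventually_at_filter)
    show "((\<lambda>t. 4 * (t * powr_dom a b t)) \<longlongrightarrow> 0) (at_right 0)"
      using ab by (intro tendsto_mult_right_zero tendsto_mult_powr_dom_0)
  qed
  show "((\<lambda>t. of_real t * rem_kernel p x t) \<longlongrightarrow> 0) at_top"
  proof (rule Lim_null_comparison)
    show "\<forall>\<^sub>F t in at_top. norm (of_real t * rem_kernel p x t) \<le> 4 * (t * powr_dom a b t)"
      using eventually_gt_at_top[of 0] by eventually_elim (rule bd)
    show "((\<lambda>t. 4 * (t * powr_dom a b t)) \<longlongrightarrow> 0) at_top"
      using ab by (intro tendsto_mult_right_zero tendsto_mult_powr_dom_at_top)
  qed
qed

section \<open>Value of the kernel integral for |x| = 1\<close>

lemma cis_shift: "cis (- (pi * (p + 1) / 2)) * \<i> = cis (- (pi * p / 2))"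
  "cis (pi * (p + 1) / 2) * (- \<i>) = cis (pi * p / 2)"
proof -
  have i: "\<i> = cis (pi / 2)" "- \<i> = cis (- (pi / 2))"
    by (auto simp: complex_eq_iff)
  show "cis (- (pi * (p + 1) / 2)) * \<i> = cis (- (pi * p / 2))"
    unfolding i(1) cis_mult by (simp add: field_simps)
  show "cis (pi * (p + 1) / 2) * (- \<i>) = cis (pi * p / 2)"
    unfolding i(2) cis_mult by (simp add: field_simps)
qed

lemma integral_rem_kernel_rec:
  assumes "p > 1" "\<bar>x\<bar> = 1"
  shows "of_real p * (LINT t:{0<..}|lborel. rem_kernel p x t) =
    of_real x * (LINT t:{0<..}|lborel. rem_kernel (p - 1) x t)"
proof -
  define m where "m = nat \<lceil>p - 1 - 1\<rceil>"
  \<comment> \<open>The hypothesis \<open>p > 1\<close> keeps \<open>nat\<close> from truncating, so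
    the Taylor degree drops by exactly one.\<close>
  have l: "nat \<lceil>p - 1\<rceil> = Suc m"
    using assms unfolding m_def by linarith
  define c where "c = cis (- (pi * (p + 1) / 2))"
  define c' where "c' = cis (pi * (p + 1) / 2)"
  have i1: "set_integrable lborel {0<..} (rem_kernel p x)"
    and i2: "set_integrable lborel {0<..} (rem_kernel (p - 1) x)"
    using assms by (auto intro!: set_integrable_rem_kernel_unit)
  have i: "set_integrable lborel {0<..} (\<lambda>t. of_real x * rem_kernel (p - 1) x t - of_real p * rem_kernel p x t)"
    by (intro set_integral_diff set_integrable_mult_right i1 i2)
  have "(LINT t:{0<..}|lborel. of_real x * rem_kernel (p - 1) x t - of_real p * rem_kernel p x t) = 0 - 0"
  proof (rule integral_FTC_Ioi[OF _ _ i])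
    fix t :: real assume t: "t > 0"
    show "((\<lambda>t. of_real t * rem_kernel p x t) has_vector_derivative
      of_real x * rem_kernel (p - 1) x t - of_real p * rem_kernel p x t) (at t)"
    proof (rule has_vector_derivative_transform_within_open[where S = "{0<..}"])
      have "((\<lambda>t. (c * iexp_rem (Suc m) (x * t) + c' * iexp_rem (Suc m) (- (x * t))) * of_real (t powr (- p)))
        has_vector_derivative
          (c * iexp_rem (Suc m) (x * t) + c' * iexp_rem (Suc m) (- (x * t))) * of_real (- p * t powr (- p - 1)) +
          (c * (\<i> * of_real x * iexp_rem m (x * t)) + c' * (- \<i> * of_real x * iexp_rem m (- (x * t)))) * of_real (t powr (- p)))
          (at t)"
        by (intro has_vector_derivative_mult has_vector_derivative_add has_vector_derivative_mult_right
            has_vector_derivative_of_real has_real_derivative_powr t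
            has_vector_derivative_iexp_rem has_vector_derivative_iexp_rem_neg)
      also have "(c * (\<i> * of_real x * iexp_rem m (x * t)) + c' * (- \<i> * of_real x * iexp_rem m (- (x * t)))) =
          of_real x * ((c * \<i>) * iexp_rem m (x * t) + (c' * (- \<i>)) * iexp_rem m (- (x * t)))"
        by (simp add: algebra_simps)
      \<comment> \<open>The factors i and -i produced by differentiation are quarter turns that
        change the phases belonging to p into those belonging to p - 1.\<close>
      also have "c * \<i> = cis (- (pi * (p - 1 + 1) / 2))"
        using cis_shift(1)[of p] by (simp add: c_def)
      also have "c' * (- \<i>) = cis (pi * (p - 1 + 1) / 2)"
        using cis_shift(2)[of p] by (simp add: c'_def)
      finally show "((\<lambda>t. (c * iexp_rem (Suc m) (x * t) + c' * iexp_rem (Suc m) (- (x * t))) * of_real (t powr (- p)))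
        has_vector_derivative of_real x * rem_kernel (p - 1) x t - of_real p * rem_kernel p x t) (at t)"
        unfolding rem_kernel_def l m_def[symmetric] c_def[symmetric] c'_def[symmetric]
        by (simp add: algebra_simps)
      show "(c * iexp_rem (Suc m) (x * t) + c' * iexp_rem (Suc m) (- (x * t))) * of_real (t powr (- p)) =
          of_real t * rem_kernel p x t" if "t \<in> {0<..}" for t
      proof -
        have "t powr (- p) = t * t powr (- p - 1)"
          using that by (simp add: powr_diff)
        then show ?thesis
          unfolding rem_kernel_def l c_def[symmetric] c'_def[symmetric] by simp
      qed
    qed (use t in auto)
  next
    show "continuous_on {0<..} (\<lambda>t. of_real x * rem_kernel (p - 1) x t - of_real p * rem_kernel p x t)"
      by (intro continuous_intros continuous_on_rem_kernel)
  qed (use assms tendsto_mult_rem_kernel[of p x] in auto)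
  also have "(LINT t:{0<..}|lborel. of_real x * rem_kernel (p - 1) x t - of_real p * rem_kernel p x t) =
      of_real x * (LINT t:{0<..}|lborel. rem_kernel (p - 1) x t) - of_real p * (LINT t:{0<..}|lborel. rem_kernel p x t)"
    unfolding set_integral_mult_right[symmetric]
    by (rule set_integral_diff) (intro set_integrable_mult_right i1 i2)+
  finally show ?thesis by simp
qed

text \<open>Here the Taylor degree is 0, so each half of the kernel is integrable by itself: it is
  the regularized integral of order b = p, at -x and at x.\<close>

lemma integral_rem_kernel_lt_1:
  assumes "0 < p" "p < 1"
  shows "(LINT t:{0<..}|lborel. rem_kernel p x t) =
    of_real (Gamma (- p)) * (cis (- (pi * (p + 1) / 2)) * ipow p (- x) + cis (pi * (p + 1) / 2) * ipow p x)"
proof -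
  have l: "nat \<lceil>p - 1\<rceil> = 0"
    using assms by linarith
  let ?g = "\<lambda>x t. (iexp (- (x * t)) - 1) / complex_of_real (t powr (1 + p))"
  have "rem_kernel p x = (\<lambda>t. cis (- (pi * (p + 1) / 2)) * ?g (- x) t + cis (pi * (p + 1) / 2) * ?g x t)"
  proof
    fix t
    have "t powr (- p - 1) = inverse (t powr (1 + p))"
    proof -
      have "- p - 1 = - (1 + p)" by simp
      then show ?thesis by (simp only: powr_minus)
    qed
    moreover have "iexp_rem 0 y = iexp y - 1" for y
      by (simp add: iexp_rem_def)
    ultimately show "rem_kernel p x t = cis (- (pi * (p + 1) / 2)) * ?g (- x) t + cis (pi * (p + 1) / 2) * ?g x t"
      by (simp only: rem_kernel_def l divide_inverse of_real_inverse distrib_right mult.assoc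
          mult_minus_left minus_minus)
  qed
  then have "(LINT t:{0<..}|lborel. rem_kernel p x t) =
      (LINT t:{0<..}|lborel. cis (- (pi * (p + 1) / 2)) * ?g (- x) t + cis (pi * (p + 1) / 2) * ?g x t)"
    by simp
  also have "\<dots> = (LINT t:{0<..}|lborel. cis (- (pi * (p + 1) / 2)) * ?g (- x) t) +
      (LINT t:{0<..}|lborel. cis (pi * (p + 1) / 2) * ?g x t)"
    by (rule set_integral_add) (intro set_integrable_mult_right set_integrable_iexp_minus_one_powr assms)+
  also have "\<dots> = cis (- (pi * (p + 1) / 2)) * (LINT t:{0<..}|lborel. ?g (- x) t) +
      cis (pi * (p + 1) / 2) * (LINT t:{0<..}|lborel. ?g x t)"
    by (simp only: set_integral_mult_right)
  finally show ?thesis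
    unfolding integral_iexp_minus_one_powr[OF assms] by (simp add: algebra_simps)
qed

text \<open>Euler's reflection formula at -p, transferred from the complex Gamma function. It also
  shows later that Gamma(-b) is nonzero.\<close>

lemma Gamma_mult_sin:
  assumes "0 < p" "p < 1"
  shows "Gamma (p + 1) * Gamma (- p) * sin (pi * p) = - pi"
proof -
  have "sin (pi * p) > 0"
    using assms by (intro sin_gt_zero) auto
  moreover have "Gamma (- p) * Gamma (1 + p) = pi / sin (pi * (- p))"
  proof -
    have "complex_of_real (Gamma (- p) * Gamma (1 + p)) = Gamma (of_real (- p)) * Gamma (1 - of_real (- p))"
      unfolding of_real_mult Gamma_complex_of_real[symmetric] by simp
    also have "\<dots> = of_real pi / sin (of_real (pi * (- p)))"
      unfolding Gamma_reflection_complex of_real_mult ..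
    also have "\<dots> = of_real (pi / sin (pi * (- p)))"
      unfolding sin_of_real of_real_divide ..
    finally show ?thesis
      unfolding of_real_eq_iff .
  qed
  ultimately show ?thesis
    by (simp add: field_simps)
qed

text \<open>Both phases equal -1, so for either sign of x the kernel is (2 - 2 cos t) / t^2. Its
  antiderivative is 2 Si t - (2 - 2 cos t) / t, and Si tends to pi/2.\<close>

lemma integral_rem_kernel_1:
  assumes "\<bar>x\<bar> = 1"
  shows "(LINT t:{0<..}|lborel. rem_kernel 1 x t) = of_real pi"
proof -
  have k: "rem_kernel 1 x t = of_real ((2 - 2 * cos t) / t\<^sup>2)" if "t > 0" for t
  proof -
    have c: "cos (x * t) = cos t"
      using assms by (auto simp: abs_if split: if_splits)
    have t: "t powr (- 2) = inverse (t\<^sup>2)"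
      using that powr_minus[of t 2] by (simp add: powr_numeral)
    have r: "- iexp_rem 0 y - iexp_rem 0 (- y) = of_real (2 - 2 * cos y)" for y
    proof -
      have "iexp_rem 0 z = cis z - 1" for z
        by (simp add: iexp_rem_def cis_conv_exp)
      then show ?thesis by (simp add: complex_eq_iff)
    qed
    have "rem_kernel 1 x t = (- iexp_rem 0 (x * t) - iexp_rem 0 (- (x * t))) * of_real (t powr (- 2))"
    proof -
      have "cis (- pi) = - 1" by (simp add: complex_eq_iff)
      then show ?thesis by (simp add: rem_kernel_def)
    qed
    also have "\<dots> = of_real ((2 - 2 * cos t) / t\<^sup>2)"
      unfolding r c t divide_inverse of_real_mult ..
    finally show ?thesis .
  qed
  have "(LINT t:{0<..}|lborel. rem_kernel 1 x t) = of_real pi - of_real 0"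
  proof (rule integral_FTC_Ioi)
    fix t :: real assume t: "t > 0"
    have "((\<lambda>t. 2 * Si t - (2 - 2 * cos t) / t) has_real_derivative
        2 * sinc t - (2 * sin t * t - (2 - 2 * cos t)) / (t * t)) (at t)"
      using t by (auto intro!: derivative_eq_intros DERIV_Si simp: mult.commute[of _ 2])
    also have "2 * sinc t - (2 * sin t * t - (2 - 2 * cos t)) / (t * t) = (2 - 2 * cos t) / t\<^sup>2"
      using t by (simp add: power2_eq_square diff_divide_distrib)
    finally show "((\<lambda>t. complex_of_real (2 * Si t - (2 - 2 * cos t) / t)) has_vector_derivative rem_kernel 1 x t) (at t)"
      unfolding k[OF t] by (rule has_vector_derivative_of_real)
  next
    have "Si 0 = 0"
      by (simp add: Si_alt_def zero_ereal_def)
    moreover have "(Si \<longlongrightarrow> Si 0) (at_right 0)"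
      using isCont_Si[of 0] by (auto simp: isCont_def filterlim_at_split)
    moreover have "((\<lambda>t::real. (2 - 2 * cos t) / t) \<longlongrightarrow> 0) (at_right 0)"
      by real_asymp
    ultimately have "((\<lambda>t. 2 * Si t - (2 - 2 * cos t) / t) \<longlongrightarrow> 2 * 0 - 0) (at_right 0)"
      by (intro tendsto_intros) auto
    then show "((\<lambda>t. complex_of_real (2 * Si t - (2 - 2 * cos t) / t)) \<longlongrightarrow> of_real 0) (at_right 0)"
      by (intro tendsto_of_real) simp
    have "((\<lambda>t::real. (2 - 2 * cos t) / t) \<longlongrightarrow> 0) at_top"
      by real_asymp
    then have "((\<lambda>t. 2 * Si t - (2 - 2 * cos t) / t) \<longlongrightarrow> 2 * (pi / 2) - 0) at_top"
      by (intro tendsto_intros Si_at_top)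
    then show "((\<lambda>t. complex_of_real (2 * Si t - (2 - 2 * cos t) / t)) \<longlongrightarrow> of_real pi) at_top"
      by (intro tendsto_of_real) simp
  qed (use assms in \<open>auto intro: continuous_on_rem_kernel set_integrable_rem_kernel_unit\<close>)
  then show ?thesis by simp
qed

text \<open>The closed form of Gamma(p+1) K(x) / (2 pi). For natural p > 0 it equals sgn(x) x^p / 2;
  the half subtracted here is what the term with f^(p+r) restores.\<close>

definition rem_value :: "real \<Rightarrow> real \<Rightarrow> real" where
  "rem_value p x = pos_power x p - of_bool (p \<in> \<nat>) * x ^ nat \<lfloor>p\<rfloor> / 2"

lemma rem_value_rec:
  assumes "p > 1" "\<bar>x\<bar> = 1"
  shows "rem_value p x = x * rem_value (p - 1) x"
proof -
  have "p - 1 \<in> \<nat> \<longleftrightarrow> p \<in> \<nat>"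
  proof
    assume "p - 1 \<in> \<nat>"
    then have "p - 1 + 1 \<in> \<nat>" by (intro Nats_add) auto
    then show "p \<in> \<nat>" by simp
  next
    assume "p \<in> \<nat>"
    then show "p - 1 \<in> \<nat>"
      using assms(1) Nats_diff[of p 1] by auto
  qed
  moreover have "nat \<lfloor>p\<rfloor> = Suc (nat \<lfloor>p - 1\<rfloor>)"
    using assms(1) by linarith
  moreover have "x = 1 \<or> x = -1"
    using assms(2) by linarith
  ultimately show ?thesis
    by (auto simp: rem_value_def pos_power_def)
qed

text \<open>Induction on the ceiling of p lowers p by one until it lies in (0, 1]. The step matches
  p K_p = x K_{p-1} with Gamma(p+1) = p Gamma(p).\<close>

lemma integral_rem_kernel_unit:
  assumes "p > 0" "\<bar>x\<bar> = 1"
  shows "of_real (Gamma (p + 1)) * (LINT t:{0<..}|lborel. rem_kernel p x t) = of_real (2 * pi * rem_value p x)"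
  using assms(1)
proof (induction "nat \<lceil>p\<rceil>" arbitrary: p rule: less_induct)
  case less
  consider "p < 1" | "p = 1" | "p > 1" by linarith
  then show ?case
  proof cases
    case 1
    have "p \<notin> \<nat>"
      using less.prems 1 by (auto elim!: Nats_cases)
    have i: "ipow p 1 = cis (pi * p / 2)" "ipow p (- 1) = cis (- (pi * p / 2))"
      by (simp_all add: ipow_conv_cis)
    \<comment> \<open>The source of the positive part. At x = 1 the phases become -(pi p + pi/2) and
      pi p + pi/2, which add up to -2 sin(pi p); at x = -1 they become -pi/2 and pi/2, which
      cancel.\<close>
    have "cis (- (pi * (p + 1) / 2)) * ipow p (- x) + cis (pi * (p + 1) / 2) * ipow p x =
        of_real (- 2 * sin (pi * p) * of_bool (x > 0))"
    proof (cases "x > 0")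
      case True
      then have x: "x = 1" using assms(2) by simp
      have e: "- (pi * (p + 1) / 2) + - (pi * p / 2) = - (pi * p + pi / 2)"
        "pi * (p + 1) / 2 + pi * p / 2 = pi * p + pi / 2"
        by (simp_all add: field_simps)
      have "cis (- (pi * (p + 1) / 2)) * ipow p (- 1) + cis (pi * (p + 1) / 2) * ipow p 1 =
          cis (- (pi * p + pi / 2)) + cis (pi * p + pi / 2)"
        unfolding i cis_mult e ..
      also have "\<dots> = of_real (2 * cos (pi * p + pi / 2))"
      proof -
        have "cis (- y) + cis y = of_real (2 * cos y)" for y
          by (simp add: complex_eq_iff)
        then show ?thesis .
      qed
      also have "cos (pi * p + pi / 2) = - sin (pi * p)"
        by (simp add: cos_add)
      finally show ?thesis by (simp add: x)
    next
      case False
      then have x: "x = - 1" using assms(2) by simp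
      have e: "- (pi * (p + 1) / 2) + pi * p / 2 = - (pi / 2)"
        "pi * (p + 1) / 2 + - (pi * p / 2) = pi / 2"
        by (simp_all add: field_simps)
      have "cis (- (pi * (p + 1) / 2)) * ipow p 1 + cis (pi * (p + 1) / 2) * ipow p (- 1) =
          cis (- (pi / 2)) + cis (pi / 2)"
        unfolding i cis_mult e ..
      also have "\<dots> = 0"
        by (simp add: complex_eq_iff)
      finally show ?thesis by (simp add: x)
    qed
    then have "of_real (Gamma (p + 1)) * (LINT t:{0<..}|lborel. rem_kernel p x t) =
        of_real (Gamma (p + 1) * (Gamma (- p) * (- 2 * sin (pi * p) * of_bool (x > 0))))"
      unfolding integral_rem_kernel_lt_1[OF less.prems 1] by simp
    also have "Gamma (p + 1) * (Gamma (- p) * (- 2 * sin (pi * p) * of_bool (x > 0))) =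
        - 2 * (Gamma (p + 1) * Gamma (- p) * sin (pi * p)) * of_bool (x > 0)"
      by simp
    also have "\<dots> = 2 * pi * rem_value p x"
      unfolding Gamma_mult_sin[OF less.prems 1] using \<open>p \<notin> \<nat>\<close> assms(2)
      by (auto simp: rem_value_def pos_power_def)
    finally show ?thesis .
  next
    case 2
    have "x = 1 \<or> x = -1"
      using assms(2) by linarith
    then have "2 * pi * rem_value p x = pi"
      using 2 by (auto simp: rem_value_def pos_power_def)
    moreover have "Gamma (p + 1) = 1"
      using 2 Gamma_fact[of 1] by simp
    ultimately show ?thesis
      using 2 integral_rem_kernel_1[OF assms(2)] by (simp only: of_real_1 mult_1)
  next
    case 3
    have IH: "of_real (Gamma p) * (LINT t:{0<..}|lborel. rem_kernel (p - 1) x t) =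
        of_real (2 * pi * rem_value (p - 1) x)"
      using less.hyps[of "p - 1"] 3 by simp
    have "Gamma (p + 1) = p * Gamma p"
    proof -
      have "p \<notin> \<int>\<^sub>\<le>\<^sub>0"
        using 3 nonpos_Ints_nonpos[of p] by auto
      then show ?thesis by (rule Gamma_plus1)
    qed
    then have "of_real (Gamma (p + 1)) * (LINT t:{0<..}|lborel. rem_kernel p x t) =
        of_real (Gamma p) * (of_real p * (LINT t:{0<..}|lborel. rem_kernel p x t))"
      by simp
    also have "\<dots> = of_real x * (of_real (Gamma p) * (LINT t:{0<..}|lborel. rem_kernel (p - 1) x t))"
      unfolding integral_rem_kernel_rec[OF 3 assms(2)] by (rule mult.left_commute)
    also have "\<dots> = of_real (2 * pi * rem_value p x)"
      unfolding IH rem_value_rec[OF 3 assms(2)] by simp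
    finally show ?thesis .
  qed
qed

section \<open>From |x| = 1 to all x by homogeneity\<close>

lemma rem_kernel_0 [simp]: "rem_kernel p 0 t = 0"
proof -
  have "iexp_rem m 0 = 0" for m
    by (simp add: iexp_rem_def power_0_left if_distrib[of "\<lambda>x. x / _"] cong: if_cong)
  then show ?thesis
    by (simp add: rem_kernel_def)
qed

text \<open>The remainders see x and t only through xt; what is left is t^{-p-1}, whose rescaling
  costs |x|^{p+1}.\<close>

lemma rem_kernel_scale:
  assumes "x \<noteq> 0" "t > 0"
  shows "rem_kernel p x t = of_real (\<bar>x\<bar> powr (p + 1)) * rem_kernel p (sgn x) (\<bar>x\<bar> * t)"
proof -
  have 1: "sgn x * (\<bar>x\<bar> * t) = x * t"
    by (simp add: sgn_if abs_if)
  have "\<bar>x\<bar> powr (p + 1) * \<bar>x\<bar> powr (- p - 1) = 1"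
    using assms by (simp flip: powr_add)
  then have 2: "t powr (- p - 1) = \<bar>x\<bar> powr (p + 1) * (\<bar>x\<bar> * t) powr (- p - 1)"
    using assms by (simp add: powr_mult)
  show ?thesis
    unfolding rem_kernel_def 1 by (subst 2) simp
qed

lemma set_integrable_rem_kernel:
  assumes "p > 0"
  shows "set_integrable lborel {0<..} (rem_kernel p x)"
proof (cases "x = 0")
  case False
  have "set_integrable lborel {0<..} (\<lambda>t. of_real (\<bar>x\<bar> powr (p + 1)) * rem_kernel p (sgn x) (\<bar>x\<bar> * t))"
    using False assms
    by (intro set_integrable_mult_right set_integrable_Ioi_scale set_integrable_rem_kernel_unit) auto
  then show ?thesis
    by (rule set_integrable_cong[THEN iffD1, rotated -1]) (use False in \<open>auto simp: rem_kernel_scale\<close>)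
qed (simp add: set_integrable_def)

lemma integral_rem_kernel:
  assumes "p > 0"
  shows "of_real (Gamma (p + 1)) * (LINT t:{0<..}|lborel. rem_kernel p x t) = of_real (2 * pi * rem_value p x)"
proof (cases "x = 0")
  case True
  then show ?thesis
    using assms by (auto simp: set_lebesgue_integral_def rem_value_def pos_power_def elim!: Nats_cases)
next
  case False
  have "(LINT t:{0<..}|lborel. rem_kernel p x t) =
      (LINT t:{0<..}|lborel. of_real (\<bar>x\<bar> powr (p + 1)) * rem_kernel p (sgn x) (\<bar>x\<bar> * t))"
    by (rule set_lebesgue_integral_cong) (use False in \<open>auto simp: rem_kernel_scale\<close>)
  also have "\<dots> = of_real (\<bar>x\<bar> powr (p + 1)) * ((LINT t:{0<..}|lborel. rem_kernel p (sgn x) t) /\<^sub>R \<bar>x\<bar>)"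
    using False by (simp add: integral_Ioi_scale)
  also have "\<dots> = of_real (\<bar>x\<bar> powr p) * (LINT t:{0<..}|lborel. rem_kernel p (sgn x) t)"
    using False by (simp add: powr_add scaleR_conv_of_real)
  finally have "of_real (Gamma (p + 1)) * (LINT t:{0<..}|lborel. rem_kernel p x t) =
      of_real (\<bar>x\<bar> powr p) * (of_real (Gamma (p + 1)) * (LINT t:{0<..}|lborel. rem_kernel p (sgn x) t))"
    by simp
  also have "\<dots> = of_real (\<bar>x\<bar> powr p * (2 * pi * rem_value p (sgn x)))"
    using False assms by (subst integral_rem_kernel_unit) auto
  also have "\<bar>x\<bar> powr p * (2 * pi * rem_value p (sgn x)) = 2 * pi * rem_value p x"
  proof -
    \<comment> \<open>Homogeneity of degree p under positive dilations; for natural p the subtracted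
      half uses |x|^p sgn(x)^p = x^p.\<close>
    have "\<bar>x\<bar> powr p * rem_value p (sgn x) = rem_value p x"
    proof (cases "p \<in> \<nat>")
      case True
      then obtain n where n: "p = real n" by (auto elim!: Nats_cases)
      have "\<bar>x\<bar> powr p = \<bar>x\<bar> ^ n"
        using False n by (simp add: powr_realpow)
      moreover have "\<bar>x\<bar> ^ n * sgn x ^ n = x ^ n"
        by (simp add: abs_mult_sgn flip: power_mult_distrib)
      ultimately show ?thesis
        using False n by (auto simp: rem_value_def pos_power_def sgn_if algebra_simps powr_realpow)
    next
      case False
      then show ?thesis
        using \<open>x \<noteq> 0\<close> by (auto simp: rem_value_def pos_power_def sgn_if)
    qed
    then show ?thesis by simp
  qed
  finally show ?thesis .
qed

text \<open>The constant adds the values at 1 and -1, which covers both signs of x without a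
  symmetry argument. The exponent is p + 1 from the scaling, less 1 from the differential.\<close>

lemma integral_norm_rem_kernel_le:
  assumes "p > 0"
  obtains C where "C \<ge> 0" "\<And>x. (LINT t:{0<..}|lborel. norm (rem_kernel p x t)) \<le> C * \<bar>x\<bar> powr p"
proof -
  define N where "N x = (LINT t:{0<..}|lborel. norm (rem_kernel p x t))" for x
  have N0: "N x \<ge> 0" for x
    unfolding N_def set_lebesgue_integral_def by (rule integral_nonneg_AE) auto
  have "N x \<le> (N 1 + N (- 1)) * \<bar>x\<bar> powr p" for x
  proof (cases "x = 0")
    case True
    then show ?thesis by (simp add: N_def set_lebesgue_integral_def)
  next
    case False
    have "N x = (LINT t:{0<..}|lborel. \<bar>x\<bar> powr (p + 1) * norm (rem_kernel p (sgn x) (\<bar>x\<bar> * t)))"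
      unfolding N_def
      by (rule set_lebesgue_integral_cong) (use False in \<open>auto simp: rem_kernel_scale norm_mult\<close>)
    also have "\<dots> = \<bar>x\<bar> powr (p + 1) * (N (sgn x) /\<^sub>R \<bar>x\<bar>)"
      using False by (simp add: N_def integral_Ioi_scale[where g = "\<lambda>t. norm (rem_kernel p (sgn x) t)"])
    also have "\<dots> = N (sgn x) * \<bar>x\<bar> powr p"
      using False by (simp add: powr_add)
    also have "\<dots> \<le> (N 1 + N (- 1)) * \<bar>x\<bar> powr p"
      using N0[of 1] N0[of "- 1"] False by (intro mult_right_mono) (auto simp: sgn_if)
    finally show ?thesis .
  qed
  then show thesis
    using N0[of 1] N0[of "- 1"] by (intro that[of "N 1 + N (- 1)"]) (auto simp: N_def)
qed

subsection \<open>Fractional derivatives of characteristic functions\<close>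

definition fourier :: "real measure \<Rightarrow> (real \<Rightarrow> complex) \<Rightarrow> real \<Rightarrow> complex" where
  "fourier M w t = (\<integral>x. w x * iexp (t * x) \<partial>M)"

text \<open>Since \<open>0 powr s = 0\<close>, integrability alone would not notice an atom at 0;
  the second clause restores the convention that 0^s is infinite for s < 0.\<close>

definition has_moment :: "real measure \<Rightarrow> real \<Rightarrow> bool" where
  "has_moment M s \<longleftrightarrow> integrable M (\<lambda>x. \<bar>x\<bar> powr s) \<and> (s < 0 \<longrightarrow> (AE x in M. x \<noteq> 0))"

lemma char_conv_fourier: "char M = fourier M (ipow 0)"
  by (simp add: fun_eq_iff char_def fourier_def)

lemma abs_powr_le_between:
  fixes x :: real
  assumes "r \<le> q" "q \<le> s"
  shows "\<bar>x\<bar> powr q \<le> \<bar>x\<bar> powr r + \<bar>x\<bar> powr s"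
proof (cases "\<bar>x\<bar> \<le> 1")
  case True
  then have "\<bar>x\<bar> powr q \<le> \<bar>x\<bar> powr r"
    using assms(1) by (intro powr_mono') auto
  then show ?thesis using powr_ge_zero[of "\<bar>x\<bar>" s] by linarith
next
  case False
  then have "\<bar>x\<bar> powr q \<le> \<bar>x\<bar> powr s"
    using assms(2) by (intro powr_mono) auto
  then show ?thesis using powr_ge_zero[of "\<bar>x\<bar>" r] by linarith
qed

text \<open>The summand 1 is there for x = 0 and s = 0, where \<open>ipow\<close> is 1 but
  \<open>powr\<close> is 0.\<close>

lemma norm_ipow_le: "norm (ipow s x) \<le> 1 + \<bar>x\<bar> powr s"
  by (cases "x = 0") (auto simp: norm_ipow, simp add: ipow_def)

context real_distribution
begin

lemma has_moment_between:
  assumes "has_moment M r" "has_moment M s" "r \<le> q" "q \<le> s"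
  shows "has_moment M q"
  unfolding has_moment_def
proof
  show "integrable M (\<lambda>x. \<bar>x\<bar> powr q)"
  proof (rule Bochner_Integration.integrable_bound)
    show "integrable M (\<lambda>x. \<bar>x\<bar> powr r + \<bar>x\<bar> powr s)"
      using assms(1,2) by (auto simp: has_moment_def)
    show "AE x in M. norm (\<bar>x\<bar> powr q) \<le> norm (\<bar>x\<bar> powr r + \<bar>x\<bar> powr s)"
      using abs_powr_le_between[OF assms(3,4)] by (intro AE_I2) simp
  qed simp
  show "q < 0 \<longrightarrow> (AE x in M. x \<noteq> 0)"
    using assms by (auto simp: has_moment_def)
qed

lemma has_moment_0: "has_moment M 0"
  unfolding has_moment_def by (auto intro!: integrable_const_bound[of _ 1])

lemma integrable_ipow:
  assumes "has_moment M s"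
  shows "integrable M (ipow s)"
proof (rule Bochner_Integration.integrable_bound)
  show "integrable M (\<lambda>x. 1 + \<bar>x\<bar> powr s)"
    using assms by (auto simp: has_moment_def)
  show "AE x in M. norm (ipow s x) \<le> norm (1 + \<bar>x\<bar> powr s)"
    using norm_ipow_le[of s] by (intro AE_I2) simp
qed simp

lemma integrable_fourier:
  assumes "integrable M w"
  shows "integrable M (\<lambda>x. w x * iexp (t * x))"
proof -
  have [measurable]: "w \<in> borel_measurable M" using assms by simp
  show ?thesis
    by (rule Bochner_Integration.integrable_bound[OF assms]) (auto simp: norm_mult)
qed

lemma fourier_cong_AE:
  assumes "w \<in> borel_measurable borel" "w' \<in> borel_measurable borel" "AE x in M. w x = w' x"
  shows "fourier M w = fourier M w'"
proof
  fix t
  have [measurable]: "w \<in> borel_measurable borel" "w' \<in> borel_measurable borel"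
    using assms by auto
  show "fourier M w t = fourier M w' t"
    unfolding fourier_def
    by (rule integral_cong_AE) (use assms(3) in \<open>auto elim: eventually_mono\<close>)
qed

lemma nth_deriv_fourier:
  assumes "\<And>j. j \<le> k \<Longrightarrow> integrable M (\<lambda>x. (\<i> * of_real x) ^ j * w x)"
  shows "nth_deriv k (fourier M w) = fourier M (\<lambda>x. (\<i> * of_real x) ^ k * w x)"
  using assms
proof (induction k)
  case 0
  then show ?case by (simp add: nth_deriv_def)
next
  case (Suc k)
  have IH: "nth_deriv k (fourier M w) = fourier M (\<lambda>x. (\<i> * of_real x) ^ k * w x)"
    using Suc by simp
  have "vector_derivative (fourier M (\<lambda>x. (\<i> * of_real x) ^ k * w x)) (at t) =
      fourier M (\<lambda>x. (\<i> * of_real x) ^ Suc k * w x) t" for t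
  proof (rule vector_derivative_at)
    have i: "integrable M (\<lambda>x. of_real x * ((\<i> * of_real x) ^ k * w x))"
    proof -
      have "integrable M (\<lambda>x. - \<i> * ((\<i> * of_real x) ^ Suc k * w x))"
        using Suc.prems[of "Suc k"] by (intro integrable_mult_right) auto
      then show ?thesis by (simp add: algebra_simps)
    qed
    have "((\<lambda>t. \<integral>x. (\<i> * of_real x) ^ k * w x * iexp (t * x) \<partial>M) has_vector_derivative
        (\<integral>x. \<i> * of_real x * ((\<i> * of_real x) ^ k * w x) * iexp (t * x) \<partial>M)) (at t)"
      by (rule has_vector_derivative_fourier[OF _ Suc.prems[of k] i]) auto
    then show "(fourier M (\<lambda>x. (\<i> * of_real x) ^ k * w x) has_vector_derivative
        fourier M (\<lambda>x. (\<i> * of_real x) ^ Suc k * w x) t) (at t)"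
      by (simp add: fourier_def[abs_def] mult.assoc)
  qed
  moreover have "nth_deriv (Suc k) (fourier M w) = (\<lambda>t. vector_derivative (nth_deriv k (fourier M w)) (at t))"
    by (simp add: nth_deriv_def)
  ultimately show ?case
    by (simp add: IH fun_eq_iff)
qed

text \<open>One integrable majorant \<open>B\<close> of the weighted absolute kernel integral yields
  both integrability in v and the interchange. Fubini is run with \<open>lborel\<close>; completion
  then passes to \<open>lebesgue\<close>, the measure in the definition of fractional
  derivatives.\<close>

lemma fubini_kernel:
  fixes k :: "real \<Rightarrow> real \<Rightarrow> complex"
  assumes [measurable]: "w \<in> borel_measurable borel" "case_prod k \<in> borel_measurable (borel \<Otimes>\<^sub>M borel)"
    "A \<in> sets borel"
    and k: "\<And>x. set_integrable lborel A (k x)"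
    and B: "AE x in M. norm (w x) * (LINT v:A|lborel. norm (k x v)) \<le> B x" "integrable M B"
  shows "set_integrable lebesgue A (\<lambda>v. \<integral>x. w x * k x v \<partial>M)"
    and "set_lebesgue_integral lebesgue A (\<lambda>v. \<integral>x. w x * k x v \<partial>M) =
      (\<integral>x. w x * (LINT v:A|lborel. k x v) \<partial>M)"
proof -
  interpret P: pair_sigma_finite M lborel
    by (intro pair_sigma_finite.intro sigma_finite_measure_axioms sigma_finite_lborel)
  define f where "f = (\<lambda>x v. indicator A v *\<^sub>R (w x * k x v))"
  have f1: "f x v = w x * (indicator A v *\<^sub>R k x v)" for x v
    by (simp add: f_def)
  have kx: "integrable lborel (\<lambda>v. indicator A v *\<^sub>R k x v)" for x
    using k by (simp add: set_integrable_def)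
  have kn: "(\<integral>v. norm (f x v) \<partial>lborel) = norm (w x) * (LINT v:A|lborel. norm (k x v))" for x
    unfolding set_lebesgue_integral_def integral_mult_right_zero[symmetric]
    by (intro Bochner_Integration.integral_cong) (auto simp: f_def norm_mult)
  have [measurable]: "case_prod f \<in> borel_measurable (M \<Otimes>\<^sub>M lborel)"
    unfolding f_def by measurable
  have i: "integrable (M \<Otimes>\<^sub>M lborel) (case_prod f)"
  proof (rule P.Fubini_integrable)
    show "integrable M (\<lambda>x. \<integral>y. norm (case_prod f (x, y)) \<partial>lborel)"
      unfolding prod.case
    proof (rule Bochner_Integration.integrable_bound[OF B(2)])
      show "(\<lambda>x. \<integral>y. norm (f x y) \<partial>lborel) \<in> borel_measurable M"
        by measurable
      show "AE x in M. norm (\<integral>y. norm (f x y) \<partial>lborel) \<le> norm (B x)"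
        using B(1)
      proof eventually_elim
        case (elim x)
        have "0 \<le> (\<integral>y. norm (f x y) \<partial>lborel)" by simp
        then show ?case using elim unfolding kn by simp
      qed
    qed
    show "AE x in M. integrable lborel (\<lambda>y. case_prod f (x, y))"
      unfolding prod.case f1 using kx by (intro AE_I2 integrable_mult_right) auto
  qed simp
  have g: "indicator A v *\<^sub>R (\<integral>x. w x * k x v \<partial>M) = (\<integral>x. f x v \<partial>M)" for v
    by (simp add: f_def)
  have gi: "integrable lborel (\<lambda>v. \<integral>x. f x v \<partial>M)"
    using P.integrable_snd[OF i] .
  then have gm: "(\<lambda>v. \<integral>x. f x v \<partial>M) \<in> borel_measurable lborel"
    by simp
  show "set_integrable lebesgue A (\<lambda>v. \<integral>x. w x * k x v \<partial>M)"
    unfolding set_integrable_def g using integrable_completion[OF gm] gi by simp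
  have "set_lebesgue_integral lebesgue A (\<lambda>v. \<integral>x. w x * k x v \<partial>M) = (\<integral>v. (\<integral>x. f x v \<partial>M) \<partial>lborel)"
    unfolding set_lebesgue_integral_def g by (rule integral_completion[OF gm])
  also have "\<dots> = (\<integral>x. (\<integral>v. f x v \<partial>lborel) \<partial>M)"
    by (rule P.Fubini_integral[OF i])
  also have "\<dots> = (\<integral>x. w x * (LINT v:A|lborel. k x v) \<partial>M)"
    unfolding f1 set_lebesgue_integral_def integral_mult_right_zero ..
  finally show "set_lebesgue_integral lebesgue A (\<lambda>v. \<integral>x. w x * k x v \<partial>M) =
      (\<integral>x. w x * (LINT v:A|lborel. k x v) \<partial>M)" .
qed

text \<open>Fubini is applied on (0, T) for fixed T, and T tends to infinity afterwards under the
  majorant C |w| |x|^s. An atom at 0 has to be excluded, because there the truncated integral grows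
  without bound.\<close>

lemma frac_int_fourier:
  assumes s: "-1 < s" "s < 0" and [measurable]: "w \<in> borel_measurable borel"
    and w: "integrable M w" and ws: "integrable M (\<lambda>x. norm (w x) * \<bar>x\<bar> powr s)"
    and nz: "AE x in M. x \<noteq> 0"
  shows "frac_int s (fourier M w) t = fourier M (\<lambda>x. w x * ipow s x) t"
proof -
  define J where "J T x = (LINT v:{0<..<T}|lborel. iexp (- (x * v)) / complex_of_real (v powr (1 + s)))" for T x
  define wt where "wt x = w x * iexp (t * x)" for x
  have [measurable]: "wt \<in> borel_measurable borel"
    unfolding wt_def[abs_def] by measurable
  have J_meas [measurable]: "J T \<in> borel_measurable borel" for T
    unfolding J_def[abs_def] set_lebesgue_integral_def by measurable
  obtain C where C: "\<And>x T. x \<noteq> 0 \<Longrightarrow> T > 0 \<Longrightarrow> norm (J T x) \<le> C * \<bar>x\<bar> powr s"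
    using norm_integral_iexp_powr_le[OF s] unfolding J_def by blast
  have eq: "set_lebesgue_integral lebesgue {0<..<T} (\<lambda>v. fourier M w (t - v) / of_real (v powr (1 + s))) =
      (\<integral>x. wt x * J T x \<partial>M)" for T
  proof -
    have "fourier M w (t - v) / of_real (v powr (1 + s)) =
        (\<integral>x. wt x * (iexp (- (x * v)) / of_real (v powr (1 + s))) \<partial>M)" for v
    proof -
      have "w x * iexp ((t - v) * x) = wt x * iexp (- (x * v))" for x
        by (simp add: wt_def exp_add[symmetric] algebra_simps)
      then show ?thesis
        by (simp add: fourier_def)
    qed
    then show ?thesis
      unfolding J_def
    proof (simp only:, intro fubini_kernel(2))
      show "set_integrable lborel {0<..<T} (\<lambda>v. iexp (- (x * v)) / complex_of_real (v powr (1 + s)))" for x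
        using s by (rule set_integrable_iexp_powr)
      \<comment> \<open>For fixed T the exponential has modulus 1, so the absolute kernel integral
        is a constant independent of x.\<close>
      show "integrable M (\<lambda>x. norm (w x) * (LINT v:{0<..<T}|lborel. 1 / v powr (1 + s)))"
        using w by simp
      show "AE x in M. norm (wt x) * (LINT v:{0<..<T}|lborel. norm (iexp (- (x * v)) / complex_of_real (v powr (1 + s))))
          \<le> norm (w x) * (LINT v:{0<..<T}|lborel. 1 / v powr (1 + s))"
        by (simp add: wt_def norm_mult norm_divide)
    qed auto
  qed
  have "((\<lambda>T. \<integral>x. wt x * J T x \<partial>M) \<longlongrightarrow> (\<integral>x. wt x * (of_real (Gamma (- s)) * ipow s x) \<partial>M)) at_top"
  proof (rule integral_dominated_convergence_at_top)
    show "integrable M (\<lambda>x. C * (norm (w x) * \<bar>x\<bar> powr s))"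
      using ws by simp
    show "\<forall>\<^sub>F T in at_top. AE x in M. norm (wt x * J T x) \<le> C * (norm (w x) * \<bar>x\<bar> powr s)"
      using eventually_gt_at_top[of 0]
    proof eventually_elim
      case (elim T)
      show ?case
        using nz
      proof eventually_elim
        case (elim x)
        have "norm (wt x * J T x) = norm (w x) * norm (J T x)"
          by (simp add: wt_def norm_mult)
        also have "\<dots> \<le> norm (w x) * (C * \<bar>x\<bar> powr s)"
          using elim \<open>0 < T\<close> by (intro mult_left_mono C) auto
        finally show ?case by (simp add: mult_ac)
      qed
    qed
    show "AE x in M. ((\<lambda>T. wt x * J T x) \<longlongrightarrow> wt x * (of_real (Gamma (- s)) * ipow s x)) at_top"
      using nz
    proof eventually_elim
      case (elim x)
      then show ?case
        unfolding J_def by (intro tendsto_mult tendsto_const integral_iexp_powr_tendsto s)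
    qed
  qed auto
  then have "Lim at_top (\<lambda>T. \<integral>x. wt x * J T x \<partial>M) = (\<integral>x. wt x * (of_real (Gamma (- s)) * ipow s x) \<partial>M)"
    by (intro tendsto_Lim) auto
  also have "\<dots> = of_real (Gamma (- s)) * fourier M (\<lambda>x. w x * ipow s x) t"
    unfolding fourier_def integral_mult_right_zero[symmetric] by (simp add: wt_def mult_ac)
  finally have "Lim at_top (\<lambda>T. \<integral>x. wt x * J T x \<partial>M) =
      of_real (Gamma (- s)) * fourier M (\<lambda>x. w x * ipow s x) t" .
  moreover have "Gamma (- s) > 0"
    using s by (intro Gamma_real_pos) auto
  ultimately show ?thesis
    unfolding frac_int_def eq by simp
qed

text \<open>For q between -(n+1) and -n, fractional integration of order q + n turns the weight
  (ix)^{-n} into (ix)^q. Then q decreases to -(n+1) by dominated convergence.\<close>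

lemma neg_int_deriv_char:
  assumes "has_moment M (- real n)"
  shows "neg_int_deriv n (char M) = fourier M (ipow (- real n))"
  using assms
proof (induction n)
  case 0
  then show ?case
    by (simp only: char_conv_fourier neg_int_deriv.simps of_nat_0 minus_zero)
next
  case (Suc n)
  note mS = Suc.prems
  have mn: "has_moment M (- real n)"
    using has_moment_between[OF mS has_moment_0] by simp
  have nz: "AE x in M. x \<noteq> 0"
    using mS by (simp add: has_moment_def)
  have fi: "frac_int (q + real n) (fourier M (ipow (- real n))) t = fourier M (ipow q) t"
    if q: "- real (Suc n) < q" "q < - real n" for q t
  proof -
    have "frac_int (q + real n) (fourier M (ipow (- real n))) t =
        fourier M (\<lambda>x. ipow (- real n) x * ipow (q + real n) x) t"
    proof (rule frac_int_fourier)
      show "integrable M (\<lambda>x. norm (ipow (- real n) x) * \<bar>x\<bar> powr (q + real n))"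
      proof -
        have "has_moment M q"
          using has_moment_between[OF mS has_moment_0, of q] q by simp
        then have "integrable M (\<lambda>x. \<bar>x\<bar> powr q)"
          by (simp add: has_moment_def)
        also have "(\<lambda>x. \<bar>x\<bar> powr q) = (\<lambda>x. norm (ipow (- real n) x) * \<bar>x\<bar> powr (q + real n))"
        proof
          show "\<bar>x\<bar> powr q = norm (ipow (- real n) x) * \<bar>x\<bar> powr (q + real n)" for x
            by (cases "x = 0") (simp_all add: norm_ipow flip: powr_add)
        qed
        finally show ?thesis .
      qed
    qed (use q nz integrable_ipow[OF mn] in auto)
    also have "fourier M (\<lambda>x. ipow (- real n) x * ipow (q + real n) x) = fourier M (ipow q)"
      using nz by (intro fourier_cong_AE) (auto elim!: eventually_mono simp flip: ipow_add)
    finally show ?thesis .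
  qed
  have "((\<lambda>q. fourier M (ipow q) t) \<longlongrightarrow> fourier M (ipow (- real (Suc n))) t) (at_right (- real (Suc n)))" for t
    unfolding tendsto_at_iff_sequentially comp_def
  proof (intro allI impI)
    fix q :: "nat \<Rightarrow> real"
    assume "\<forall>i. q i \<in> {- real (Suc n)<..} - {- real (Suc n)}" and q: "q \<longlonglongrightarrow> - real (Suc n)"
    then have gt: "q i > - real (Suc n)" for i by auto
    have "\<forall>\<^sub>F i in sequentially. q i < - real n"
      using order_tendstoD(2)[OF q, of "- real n"] by simp
    \<comment> \<open>Dropping the first \<open>N\<close> terms keeps the order between -(n+1) and
      0, so the two endpoint powers and the constant 1 form an integrable majorant.\<close>
    then obtain N where N: "\<And>i. i \<ge> N \<Longrightarrow> q i < - real n"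
      by (auto simp: eventually_sequentially)
    have "(\<lambda>i. fourier M (ipow (q (i + N))) t) \<longlonglongrightarrow> fourier M (ipow (- real (Suc n))) t"
      unfolding fourier_def
    proof (rule integral_dominated_convergence)
      show "integrable M (\<lambda>x. 1 + (\<bar>x\<bar> powr (- real (Suc n)) + \<bar>x\<bar> powr 0))"
        using mS has_moment_0 by (auto simp: has_moment_def)
      show "AE x in M. norm (ipow (q (i + N)) x * iexp (t * x)) \<le> 1 + (\<bar>x\<bar> powr (- real (Suc n)) + \<bar>x\<bar> powr 0)" for i
      proof (rule AE_I2)
        fix x
        have "norm (ipow (q (i + N)) x * iexp (t * x)) \<le> 1 + \<bar>x\<bar> powr q (i + N)"
          using norm_ipow_le by (simp add: norm_mult)
        also have "\<bar>x\<bar> powr q (i + N) \<le> \<bar>x\<bar> powr (- real (Suc n)) + \<bar>x\<bar> powr 0"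
          using N[of "i + N"] gt[of "i + N"] by (intro abs_powr_le_between) auto
        finally show "norm (ipow (q (i + N)) x * iexp (t * x)) \<le> 1 + (\<bar>x\<bar> powr (- real (Suc n)) + \<bar>x\<bar> powr 0)"
          by simp
      qed
      show "AE x in M. (\<lambda>i. ipow (q (i + N)) x * iexp (t * x)) \<longlonglongrightarrow> ipow (- real (Suc n)) x * iexp (t * x)"
        using nz
      proof eventually_elim
        case (elim x)
        have "(\<lambda>i. q (i + N)) \<longlonglongrightarrow> - real (Suc n)"
          using q by (rule LIMSEQ_ignore_initial_segment)
        then show ?case
          unfolding ipow_conv_cis[OF elim] using elim by (intro tendsto_intros) auto
      qed
    qed auto
    then show "(\<lambda>i. fourier M (ipow (q i)) t) \<longlonglongrightarrow> fourier M (ipow (- real (Suc n))) t"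
      by (rule LIMSEQ_offset)
  qed
  moreover have "\<forall>\<^sub>F q in at_right (- real (Suc n)).
      fourier M (ipow q) t = frac_int (q + real n) (neg_int_deriv n (char M)) t" for t
    unfolding eventually_at_right_field Suc.IH[OF mn]
    by (intro exI[of _ "- real n"]) (auto simp: fi)
  ultimately have "((\<lambda>q. frac_int (q + real n) (neg_int_deriv n (char M)) t) \<longlongrightarrow>
      fourier M (ipow (- real (Suc n))) t) (at_right (- real (Suc n)))" for t
    by (rule Lim_transform_eventually)
  then have "Lim (at_right (- real (Suc n))) (\<lambda>q. frac_int (q + real n) (neg_int_deriv n (char M)) t) =
      fourier M (ipow (- real (Suc n))) t" for t
    by (intro tendsto_Lim) simp_all
  then show ?case
    by (simp only: neg_int_deriv.simps)
qed

text \<open>With s = k + b, the k-th derivative contributes (ix)^k and the singular integral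
  contributes Gamma(-b) (ix)^b, the interchange being covered by C |x|^s. The prefactor 1 /
  Gamma(-b) then cancels.\<close>

lemma frac_deriv_pos_nonint:
  assumes s: "s > 0" "s \<notin> \<nat>" and m: "has_moment M s"
  shows "frac_deriv s (char M) t = fourier M (ipow s) t"
proof -
  define k where "k = nat \<lfloor>s\<rfloor>"
  define b where "b = frac s"
  have k: "real k = of_int \<lfloor>s\<rfloor>"
    using s by (simp add: k_def)
  have sk: "s = real k + b"
    unfolding k b_def by (simp add: frac_def)
  have "s \<notin> \<int>"
    using s by (simp add: Nats_altdef2)
  then have b: "0 < b" "b < 1"
    using frac_gt_0_iff[of s] frac_lt_1[of s] by (auto simp: b_def)
  have mj: "has_moment M (real j)" if "j \<le> k" for j
    using has_moment_between[OF has_moment_0 m, of "real j"] that sk b by simp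
  have nd: "nth_deriv k (char M) = fourier M (ipow (real k))"
  proof -
    have "nth_deriv k (char M) = fourier M (\<lambda>x. (\<i> * of_real x) ^ k * ipow 0 x)"
      unfolding char_conv_fourier
      by (rule nth_deriv_fourier) (use integrable_ipow[OF mj] in \<open>simp add: ipow_of_nat[symmetric]\<close>)
    then show ?thesis by (simp add: ipow_of_nat[abs_def])
  qed
  define wt where "wt x = ipow (real k) x * iexp (t * x)" for x
  have [measurable]: "wt \<in> borel_measurable borel"
    unfolding wt_def[abs_def] by measurable
  let ?k = "\<lambda>x v. (iexp (- (x * v)) - 1) / complex_of_real (v powr (1 + b))"
  have diff: "(fourier M (ipow (real k)) (t - v) - fourier M (ipow (real k)) t) / of_real (v powr (1 + b)) =
      (\<integral>x. wt x * ?k x v \<partial>M)" for v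
  proof -
    have "fourier M (ipow (real k)) (t - v) - fourier M (ipow (real k)) t =
        (\<integral>x. ipow (real k) x * iexp ((t - v) * x) - ipow (real k) x * iexp (t * x) \<partial>M)"
      unfolding fourier_def
      by (rule Bochner_Integration.integral_diff[symmetric]) (intro integrable_fourier integrable_ipow mj order_refl)+
    also have "\<dots> = (\<integral>x. wt x * (iexp (- (x * v)) - 1) \<partial>M)"
      by (rule Bochner_Integration.integral_cong) (simp_all add: wt_def algebra_simps flip: exp_add)
    finally show ?thesis
      by simp
  qed
  obtain C where C: "C \<ge> 0" "\<And>x. (LINT v:{0<..}|lborel. norm (?k x v)) \<le> C * \<bar>x\<bar> powr b"
    using integral_norm_iexp_minus_one_powr[OF b] by blast
  have "set_lebesgue_integral lebesgue {0<..} (\<lambda>v. \<integral>x. wt x * ?k x v \<partial>M) =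
      (\<integral>x. wt x * (LINT v:{0<..}|lborel. ?k x v) \<partial>M)"
  proof (rule fubini_kernel(2))
    show "set_integrable lborel {0<..} (?k x)" for x
      using b by (rule set_integrable_iexp_minus_one_powr)
    show "integrable M (\<lambda>x. C * \<bar>x\<bar> powr s)"
      using m by (simp add: has_moment_def)
    show "AE x in M. norm (wt x) * (LINT v:{0<..}|lborel. norm (?k x v)) \<le> C * \<bar>x\<bar> powr s"
    proof (rule AE_I2)
      fix x
      have "norm (wt x) * (LINT v:{0<..}|lborel. norm (?k x v)) \<le> norm (wt x) * (C * \<bar>x\<bar> powr b)"
        by (rule mult_left_mono[OF C(2)]) simp
      also have "\<dots> = C * \<bar>x\<bar> powr s"
        using sk by (cases "x = 0") (simp_all add: wt_def norm_mult norm_ipow powr_add)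
      finally show "norm (wt x) * (LINT v:{0<..}|lborel. norm (?k x v)) \<le> C * \<bar>x\<bar> powr s" .
    qed
  qed auto
  also have "\<dots> = (\<integral>x. of_real (Gamma (- b)) * (ipow s x * iexp (t * x)) \<partial>M)"
  proof (rule Bochner_Integration.integral_cong)
    show "wt x * (LINT v:{0<..}|lborel. ?k x v) = of_real (Gamma (- b)) * (ipow s x * iexp (t * x))" for x
      unfolding integral_iexp_minus_one_powr[OF b]
      using b sk ipow_add[of x "real k" b] by (cases "x = 0") (auto simp: wt_def ipow_def)
  qed simp
  finally have I: "set_lebesgue_integral lebesgue {0<..} (\<lambda>v. \<integral>x. wt x * ?k x v \<partial>M) =
      of_real (Gamma (- b)) * fourier M (ipow s) t"
    by (simp add: fourier_def)
  have "Gamma (- b) \<noteq> 0"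
    using Gamma_mult_sin[OF b] pi_gt_zero by auto
  then show ?thesis
    using s unfolding frac_deriv_def k_def[symmetric] b_def[symmetric] nd diff I by simp
qed

text \<open>The cases follow the branches of the definition; lower orders have moments because they
  lie between 0 and \<open>s\<close>.\<close>

lemma frac_deriv_char:
  assumes m: "has_moment M s"
  shows "frac_deriv s (char M) = fourier M (ipow s)"
proof
  fix t
  consider (nat) "s \<in> \<nat>" | (pos) "s > 0" "s \<notin> \<nat>" | (negint) n where "s = - real n" 
    | (neg) "s < 0" "s \<notin> \<int>"
  proof -
    have "\<exists>n. s = - real n" if "s \<le> 0" "s \<in> \<int>"
    proof -
      obtain z where "s = of_int z" using \<open>s \<in> \<int>\<close> by (auto elim: Ints_cases)
      then show ?thesis using that by (intro exI[of _ "nat (- z)"]) auto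
    qed
    then show thesis using that by (metis Ints_0 linorder_not_less order_le_less)
  qed
  then show "frac_deriv s (char M) t = fourier M (ipow s) t"
  proof cases
    case nat
    then obtain k where k: "s = real k" by (auto elim: Nats_cases)
    have mj: "has_moment M (real j)" if "j \<le> k" for j
      using has_moment_between[OF has_moment_0 m, of "real j"] that k by simp
    have "nth_deriv k (char M) = fourier M (\<lambda>x. (\<i> * of_real x) ^ k * ipow 0 x)"
      unfolding char_conv_fourier
      by (rule nth_deriv_fourier) (use integrable_ipow[OF mj] in \<open>simp add: ipow_of_nat[symmetric]\<close>)
    then show ?thesis
      by (simp add: k frac_deriv_of_nat ipow_of_nat[abs_def])
  next
    case pos
    then show ?thesis using m by (rule frac_deriv_pos_nonint)
  next
    case negint
    then show ?thesis
      using m neg_int_deriv_char[of n] by (simp add: frac_deriv_neg_of_nat)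
  next
    case neg
    \<comment> \<open>The order splits as -n plus a fractional part in (-1, 0); n = 0 covers -1 < s
      < 0.\<close>
    define n where "n = nat (- \<lceil>s\<rceil>)"
    have c: "of_int \<lceil>s\<rceil> = - real n"
      using neg by (simp add: n_def)
    have "s \<noteq> of_int \<lceil>s\<rceil>"
      using neg(2) by (metis Ints_of_int)
    then have b: "-1 < s + real n" "s + real n < 0"
      using c by linarith+
    have mn: "has_moment M (- real n)"
      using has_moment_between[OF m has_moment_0, of "- real n"] b by simp
    have nz: "AE x in M. x \<noteq> 0"
      using m neg by (simp add: has_moment_def)
    have "frac_deriv s (char M) t = frac_int (s + real n) (fourier M (ipow (- real n))) t"
      unfolding frac_deriv_neg_nonint[OF neg] c frac_deriv_neg_of_nat neg_int_deriv_char[OF mn]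
      using b by (simp add: frac_deriv_between_m1_0)
    also have "\<dots> = fourier M (\<lambda>x. ipow (- real n) x * ipow (s + real n) x) t"
    proof (rule frac_int_fourier)
      have "\<bar>x\<bar> powr s = norm (ipow (- real n) x) * \<bar>x\<bar> powr (s + real n)" for x
        by (cases "x = 0") (simp_all add: norm_ipow flip: powr_add)
      then show "integrable M (\<lambda>x. norm (ipow (- real n) x) * \<bar>x\<bar> powr (s + real n))"
        using m by (simp add: has_moment_def)
    qed (use b nz integrable_ipow[OF mn] in auto)
    also have "fourier M (\<lambda>x. ipow (- real n) x * ipow (s + real n) x) = fourier M (ipow s)"
      using nz by (intro fourier_cong_AE) (auto elim!: eventually_mono simp flip: ipow_add)
    finally show ?thesis .
  qed
qed

end

subsection \<open>Positive-part moments\<close>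

text \<open>For s < 0 the value \<open>abs_power 0 s = \<infinity>\<close> forces X to be nonzero
  almost surely when the moment is finite. Elsewhere \<open>abs_power\<close> dominates
  \<open>powr\<close>.\<close>

lemma has_moment_distr:
  assumes [measurable]: "X \<in> borel_measurable M" and fin: "abs_moment M X s < \<infinity>"
  shows "has_moment (distr M borel X) s"
proof -
  have [measurable]: "(\<lambda>x. abs_power x s) \<in> borel_measurable borel"
    unfolding abs_power_def by measurable
  have fin': "(\<integral>\<^sup>+ x. abs_power x s \<partial>distr M borel X) < \<infinity>"
    using fin by (simp add: abs_moment_def nn_integral_distr)
  have "AE x in distr M borel X. abs_power x s \<noteq> \<infinity>"
    using fin' by (intro nn_integral_noteq_infinite) auto
  then have nz: "s < 0 \<longrightarrow> (AE x in distr M borel X. x \<noteq> 0)"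
    by (auto simp: abs_power_def elim!: eventually_mono split: if_splits)
  have "(\<integral>\<^sup>+ x. ennreal (norm (\<bar>x\<bar> powr s)) \<partial>distr M borel X) \<le> (\<integral>\<^sup>+ x. abs_power x s \<partial>distr M borel X)"
    by (intro nn_integral_mono) (auto simp: abs_power_def)
  then have "integrable (distr M borel X) (\<lambda>x. \<bar>x\<bar> powr s)"
    using fin' by (intro integrableI_bounded) auto
  with nz show ?thesis by (simp add: has_moment_def)
qed

lemma norm_rem_value_le:
  assumes "p > 0"
  shows "\<bar>rem_value p x\<bar> \<le> 2 * \<bar>x\<bar> powr p"
proof (cases "p \<in> \<nat>")
  case True
  then obtain n where n: "p = real n" by (auto elim: Nats_cases)
  have "\<bar>x\<bar> powr p = \<bar>x\<bar> ^ n"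
    using n assms by (cases "x = 0") (auto simp: powr_realpow)
  moreover have "\<bar>pos_power x p\<bar> \<le> \<bar>x\<bar> powr p"
    by (simp add: pos_power_def)
  ultimately show ?thesis
    using abs_triangle_ineq4[of "pos_power x p" "x ^ n / 2"] zero_le_power_abs[of x n]
    by (simp add: rem_value_def n power_abs)
next
  case False
  then show ?thesis
    by (simp add: rem_value_def pos_power_def)
qed

lemma rem_value_measurable [measurable]: "rem_value p \<in> borel_measurable borel"
  unfolding rem_value_def pos_power_def by measurable

text \<open>Both terms on the right are multiples of c = (ix)^r / i^r when x \<noteq> 0: the first
  is c x^p / 2 for natural p, and the second is c times \<open>rem_value p x\<close>, so the halves
  recombine to c x_+^p. Here c is x^r for x > 0, and x_+^p vanishes for x < 0. At x = 0 the
  condition r \<ge> 0 makes p + r positive; with p + r = 0 and p natural the first term would be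
  1/2.\<close>

lemma pos_power_conv_rem_value:
  assumes "p > 0" "x \<noteq> 0 \<or> r \<ge> 0"
  shows "complex_of_real (pos_power x (r + p)) =
    of_bool (p \<in> \<nat>) * ipow (p + r) x / (2 * \<i> powr of_real (p + r)) +
    ipow r x * of_real (rem_value p x) / \<i> powr of_real r"
proof (cases "x = 0")
  case True
  then have "r + p \<noteq> 0" "rem_value p x = 0"
    using assms by (auto simp: rem_value_def pos_power_def elim!: Nats_cases)
  then show ?thesis
    using True by (simp add: ipow_def pos_power_def add.commute)
next
  case False
  define c where "c = ipow r x / \<i> powr of_real r"
  have i: "\<i> powr of_real s = ipow s 1" for s
    by (simp add: ipow_def)
  have nz: "ipow s 1 \<noteq> 0" for s
    by (simp add: ipow_def)
  have 1: "c * of_real (pos_power x p) = of_real (pos_power x (r + p))"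
  proof (cases "x > 0")
    case True
    then have "c = of_real (x powr r)"
      unfolding c_def i using nz[of r] by (simp add: ipow_conv_cis)
    then show ?thesis
      using True by (simp add: pos_power_def powr_add)
  qed (simp add: pos_power_def)
  have 2: "ipow (p + r) x / \<i> powr of_real (p + r) = c * of_real (x ^ nat \<lfloor>p\<rfloor>)" if "p \<in> \<nat>"
  proof -
    obtain n where n: "p = real n" using \<open>p \<in> \<nat>\<close> by (auto elim: Nats_cases)
    have "ipow p x = ipow p 1 * of_real (x ^ n)"
      by (simp add: n ipow_of_nat power_mult_distrib)
    then have "ipow (p + r) x / ipow (p + r) 1 = c * of_real (x ^ n)"
      using False nz[of p] nz[of r] by (simp add: ipow_add c_def i)
    then show ?thesis
      unfolding i by (simp only: n floor_of_nat nat_int)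
  qed
  have "of_bool (p \<in> \<nat>) * ipow (p + r) x / (2 * \<i> powr of_real (p + r)) +
      ipow r x * of_real (rem_value p x) / \<i> powr of_real r =
      of_bool (p \<in> \<nat>) * (ipow (p + r) x / \<i> powr of_real (p + r)) / 2 + c * of_real (rem_value p x)"
    by (simp add: c_def)
  also have "\<dots> = c * of_real (pos_power x p)"
    using 2 by (cases "p \<in> \<nat>") (simp_all add: rem_value_def algebra_simps)
  finally show ?thesis
    using 1 by simp
qed

text \<open>Dividing by (it)^{p+1} and (-it)^{p+1} inverts their phases, which produces the
  coefficients of \<open>rem_kernel\<close>.\<close>

lemma divide_ii_powr_add:
  assumes "t > 0"
  shows "a / (\<i> * of_real t) powr of_real (p + 1) + b / (- \<i> * of_real t) powr of_real (p + 1) =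
    (cis (- (pi * (p + 1) / 2)) * a + cis (pi * (p + 1) / 2) * b) * of_real (t powr (- p - 1))"
proof -
  have t: "t powr (- p - 1) = inverse (t powr (p + 1))"
    using powr_minus[of t "p + 1"] by (simp only: minus_add_distrib) simp
  have 1: "(\<i> * of_real t) powr of_real (p + 1) = of_real (t powr (p + 1)) * cis (pi * (p + 1) / 2)"
    using ii_times_powr[of t "p + 1"] assms by simp
  have 2: "(- \<i> * of_real t) powr of_real (p + 1) = of_real (t powr (p + 1)) * cis (- (pi * (p + 1) / 2))"
    using ii_times_powr[of "- t" "p + 1"] assms by simp
  have c: "inverse (cis y) = cis (- y)" for y
    by simp
  show ?thesis
    unfolding 1 2 t divide_inverse[of a] divide_inverse[of b] inverse_mult_distrib c minus_minus of_real_inverse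
    by (simp only: distrib_left mult_ac)
qed

context real_distribution
begin

text \<open>The order r + j lies between r and r + p. The majorant contains
  \<open>norm (ipow r x)\<close> rather than \<open>\<bar>x\<bar> powr r\<close> so that it also
  covers x = 0 with r = 0 and j = 0.\<close>

lemma integrable_power_ipow:
  assumes "has_moment M r" "has_moment M (r + p)" "real j \<le> p"
  shows "integrable M (\<lambda>x. (\<i> * of_real x) ^ j * ipow r x)"
proof (rule Bochner_Integration.integrable_bound)
  show "integrable M (\<lambda>x. norm (ipow r x) + \<bar>x\<bar> powr (r + p))"
    using assms(2) integrable_ipow[OF assms(1)] by (auto simp: has_moment_def)
  have "norm ((\<i> * of_real x) ^ j * ipow r x) \<le> norm (ipow r x) + \<bar>x\<bar> powr (r + p)" for x
  proof (cases "x = 0")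
    case False
    have "norm ((\<i> * of_real x) ^ j * ipow r x) = \<bar>x\<bar> powr (r + real j)"
      using False by (simp add: norm_mult norm_power norm_ipow powr_add powr_realpow)
    also have "\<dots> \<le> \<bar>x\<bar> powr r + \<bar>x\<bar> powr (r + p)"
      using assms(3) by (intro abs_powr_le_between) auto
    finally show ?thesis using False by (simp add: norm_ipow)
  qed (cases j, auto)
  then show "AE x in M. norm ((\<i> * of_real x) ^ j * ipow r x) \<le> norm (norm (ipow r x) + \<bar>x\<bar> powr (r + p))"
    by (intro AE_I2) simp
qed simp

lemma taylor_rem_fourier:
  assumes "\<And>j. j \<le> l \<Longrightarrow> integrable M (\<lambda>x. (\<i> * of_real x) ^ j * w x)"
  shows "integrable M (\<lambda>x. w x * iexp (u * x) * iexp_rem l (x * t))"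
    and "taylor_rem l (fourier M w) u t = (\<integral>x. w x * iexp (u * x) * iexp_rem l (x * t) \<partial>M)"
proof -
  have e: "w x * iexp (u * x) * iexp_rem l (x * t) =
      w x * iexp ((u + t) * x) - (\<Sum>j=0..l. (\<i> * of_real x) ^ j * w x * iexp (u * x) * of_real (t ^ j / fact j))" for x
  proof -
    have "w x * iexp (u * x) * iexp (x * t) = w x * iexp ((u + t) * x)"
      by (simp add: algebra_simps flip: exp_add)
    moreover have "w x * iexp (u * x) * (\<Sum>j\<le>l. (\<i> * of_real (x * t)) ^ j / fact j) =
        (\<Sum>j=0..l. (\<i> * of_real x) ^ j * w x * iexp (u * x) * of_real (t ^ j / fact j))"
      unfolding sum_distrib_left atMost_atLeast0
      by (rule sum.cong) (simp_all add: power_mult_distrib)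
    ultimately show ?thesis
      by (simp add: iexp_rem_def right_diff_distrib)
  qed
  have i0: "integrable M (\<lambda>x. w x * iexp ((u + t) * x))"
    using assms[of 0] by (intro integrable_fourier) simp
  have ij: "integrable M (\<lambda>x. (\<i> * of_real x) ^ j * w x * iexp (u * x) * of_real (t ^ j / fact j))" if "j \<le> l" for j
    by (intro integrable_mult_left integrable_fourier[OF assms] that)
  show "integrable M (\<lambda>x. w x * iexp (u * x) * iexp_rem l (x * t))"
    unfolding e by (intro Bochner_Integration.integrable_diff Bochner_Integration.integrable_sum i0 ij) auto
  have "(\<integral>x. w x * iexp (u * x) * iexp_rem l (x * t) \<partial>M) =
      fourier M w (u + t) - (\<Sum>j=0..l. (\<integral>x. (\<i> * of_real x) ^ j * w x * iexp (u * x) * of_real (t ^ j / fact j) \<partial>M))"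
  proof -
    have "(\<integral>x. (\<Sum>j=0..l. (\<i> * of_real x) ^ j * w x * iexp (u * x) * of_real (t ^ j / fact j)) \<partial>M) =
        (\<Sum>j=0..l. (\<integral>x. (\<i> * of_real x) ^ j * w x * iexp (u * x) * of_real (t ^ j / fact j) \<partial>M))"
      by (rule Bochner_Integration.integral_sum) (rule ij, simp)
    then show ?thesis
      unfolding e fourier_def
      by (subst Bochner_Integration.integral_diff[OF i0])
        (auto intro!: Bochner_Integration.integrable_sum ij simp del: of_real_divide of_real_mult)
  qed
  also have "\<dots> = taylor_rem l (fourier M w) u t"
    unfolding taylor_rem_def
    by (intro arg_cong2[where f = "(-)"] sum.cong refl)
      (simp add: nth_deriv_fourier[of _ w] assms fourier_def del: of_real_divide)
  finally show "taylor_rem l (fourier M w) u t = (\<integral>x. w x * iexp (u * x) * iexp_rem l (x * t) \<partial>M)" ..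
qed

lemma pos_power_moment:
  fixes p r u :: real
  assumes p: "p > 0" and mr: "has_moment M r" and mp: "has_moment M (r + p)"
    and l: "l = nat \<lceil>p - 1\<rceil>"
    and F: "F = (\<lambda>t::real.
      taylor_rem l (frac_deriv r (char M)) u t / (\<i> * of_real t) powr of_real (p + 1)
    + taylor_rem l (frac_deriv r (char M)) u (- t) / (- \<i> * of_real t) powr of_real (p + 1))"
  shows "set_integrable lebesgue {0<..} F"
    and "(\<integral>x. of_real (pos_power x (r + p)) * iexp (u * x) \<partial>M)
      = frac_deriv (p + r) (char M) u / (2 * \<i> powr of_real (p + r)) * of_bool (p \<in> \<nat>)
      + of_real (Gamma (p + 1)) / (2 * of_real pi * \<i> powr of_real r)
        * set_lebesgue_integral lebesgue {0<..} F"
proof -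
  define wt where "wt x = ipow r x * iexp (u * x)" for x
  have [measurable]: "wt \<in> borel_measurable borel"
    unfolding wt_def[abs_def] by measurable
  have lp: "real l < p"
    using nat_ceiling_minus_1(2)[OF p] by (simp add: l)
  have ij: "integrable M (\<lambda>x. (\<i> * of_real x) ^ j * ipow r x)" if "j \<le> l" for j
    using mr mp that lp by (intro integrable_power_ipow[where p = p]) auto
  \<comment> \<open>Restricted to t > 0, like the polar form of the denominators; the integral runs
    over \<open>{0<..}\<close> only.\<close>
  have Ft: "F t = (\<integral>x. wt x * rem_kernel p x t \<partial>M)" if t: "t > 0" for t
  proof -
    have i1: "integrable M (\<lambda>x. wt x * iexp_rem l (x * t))"
      and i2: "integrable M (\<lambda>x. wt x * iexp_rem l (- (x * t)))"
      using taylor_rem_fourier(1)[OF ij, of l u t] taylor_rem_fourier(1)[OF ij, of l u "- t"]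
      by (simp_all add: wt_def)
    let ?c = "cis (- (pi * (p + 1) / 2))" and ?c' = "cis (pi * (p + 1) / 2)"
    have "F t = (?c * (\<integral>x. wt x * iexp_rem l (x * t) \<partial>M) + ?c' * (\<integral>x. wt x * iexp_rem l (- (x * t)) \<partial>M)) *
        of_real (t powr (- p - 1))"
      unfolding F frac_deriv_char[OF mr] divide_ii_powr_add[OF t]
      using taylor_rem_fourier(2)[OF ij, of l u t] taylor_rem_fourier(2)[OF ij, of l u "- t"]
      by (simp add: wt_def)
    also have "\<dots> = (\<integral>x. (?c * (wt x * iexp_rem l (x * t)) + ?c' * (wt x * iexp_rem l (- (x * t)))) *
        of_real (t powr (- p - 1)) \<partial>M)"
      by (simp add: i1 i2)
    also have "\<dots> = (\<integral>x. wt x * rem_kernel p x t \<partial>M)"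
      unfolding rem_kernel_def l[symmetric]
      by (rule Bochner_Integration.integral_cong) (simp_all only: distrib_left mult_ac)
    finally show ?thesis .
  qed
  obtain C where C: "C \<ge> 0" "\<And>x. (LINT t:{0<..}|lborel. norm (rem_kernel p x t)) \<le> C * \<bar>x\<bar> powr p"
    using integral_norm_rem_kernel_le[OF p] by blast
  \<comment> \<open>This is where the moment of order r + p supplies the Fubini majorant. At x = 0
    both sides are 0 because \<open>powr\<close> vanishes there.\<close>
  have nw: "norm (wt x) * \<bar>x\<bar> powr p = \<bar>x\<bar> powr (r + p)" for x
    by (cases "x = 0") (simp_all add: wt_def norm_mult norm_ipow powr_add)
  have [measurable]: "case_prod (rem_kernel p) \<in> borel_measurable (borel \<Otimes>\<^sub>M borel)"
    unfolding rem_kernel_def by measurable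
  have B: "AE x in M. norm (wt x) * (LINT t:{0<..}|lborel. norm (rem_kernel p x t)) \<le> C * \<bar>x\<bar> powr (r + p)"
  proof (rule AE_I2)
    show "norm (wt x) * (LINT t:{0<..}|lborel. norm (rem_kernel p x t)) \<le> C * \<bar>x\<bar> powr (r + p)" for x
      using mult_left_mono[OF C(2)[of x], of "norm (wt x)"] nw[of x] by (simp add: mult.left_commute)
  qed
  have Bi: "integrable M (\<lambda>x. C * \<bar>x\<bar> powr (r + p))"
    using mp by (simp add: has_moment_def)
  note fub = fubini_kernel[OF _ _ _ set_integrable_rem_kernel[OF p] B Bi]
  show "set_integrable lebesgue {0<..} F"
  proof (rule set_integrable_cong[THEN iffD1, rotated -1])
    show "set_integrable lebesgue {0<..} (\<lambda>t. \<integral>x. wt x * rem_kernel p x t \<partial>M)"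
      by (rule fub(1)) auto
  qed (auto simp: Ft)
  have "set_lebesgue_integral lebesgue {0<..} F =
      set_lebesgue_integral lebesgue {0<..} (\<lambda>t. \<integral>x. wt x * rem_kernel p x t \<partial>M)"
    by (rule set_lebesgue_integral_cong) (auto simp: Ft)
  also have "\<dots> = (\<integral>x. wt x * (LINT t:{0<..}|lborel. rem_kernel p x t) \<partial>M)"
    by (rule fub(2)) auto
  finally have "of_real (Gamma (p + 1)) * set_lebesgue_integral lebesgue {0<..} F =
      (\<integral>x. of_real (Gamma (p + 1)) * (wt x * (LINT t:{0<..}|lborel. rem_kernel p x t)) \<partial>M)"
    by simp
  also have "\<dots> = (\<integral>x. 2 * of_real pi * (wt x * of_real (rem_value p x)) \<partial>M)"
  proof (rule Bochner_Integration.integral_cong)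
    show "of_real (Gamma (p + 1)) * (wt x * (LINT t:{0<..}|lborel. rem_kernel p x t)) =
        2 * of_real pi * (wt x * of_real (rem_value p x))" for x
      unfolding mult.left_commute[of "of_real (Gamma (p + 1))"] integral_rem_kernel[OF p] by simp
  qed simp
  finally have I: "of_real (Gamma (p + 1)) * set_lebesgue_integral lebesgue {0<..} F =
      2 * of_real pi * (\<integral>x. wt x * of_real (rem_value p x) \<partial>M)"
    by simp
  have mpr: "has_moment M (p + r)"
    using mp by (simp add: add.commute)
  have i1: "integrable M (\<lambda>x. ipow (p + r) x * iexp (u * x))"
    using mpr by (intro integrable_fourier integrable_ipow)
  have i2: "integrable M (\<lambda>x. wt x * of_real (rem_value p x))"
  proof (rule Bochner_Integration.integrable_bound)
    show "integrable M (\<lambda>x. 2 * \<bar>x\<bar> powr (r + p))"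
      using mp by (simp add: has_moment_def)
    show "AE x in M. norm (wt x * of_real (rem_value p x)) \<le> norm (2 * \<bar>x\<bar> powr (r + p))"
    proof (rule AE_I2)
      show "norm (wt x * of_real (rem_value p x)) \<le> norm (2 * \<bar>x\<bar> powr (r + p))" for x
        using mult_left_mono[OF norm_rem_value_le[OF p, of x], of "norm (wt x)"] nw[of x]
        by (simp add: norm_mult mult.left_commute)
    qed
  qed measurable
  let ?b = "of_bool (p \<in> \<nat>) / (2 * \<i> powr of_real (p + r))" and ?d = "1 / \<i> powr of_real r"
  have [measurable]: "(\<lambda>x. pos_power x (r + p)) \<in> borel_measurable borel"
    unfolding pos_power_def by measurable
  \<comment> \<open>For r < 0 the moment of order r excludes an atom at 0; for r \<ge> 0 the
    pointwise identity holds at 0 as well.\<close>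
  have "AE x in M. x \<noteq> 0 \<or> r \<ge> 0"
    using mr by (cases "r < 0") (auto simp: has_moment_def elim!: eventually_mono)
  then have "AE x in M. of_real (pos_power x (r + p)) * iexp (u * x) =
      ?b * (ipow (p + r) x * iexp (u * x)) + ?d * (wt x * of_real (rem_value p x))"
  proof eventually_elim
    case (elim x)
    show ?case
      unfolding pos_power_conv_rem_value[OF p elim] wt_def by (simp add: distrib_right)
  qed
  then have "(\<integral>x. of_real (pos_power x (r + p)) * iexp (u * x) \<partial>M) =
      (\<integral>x. ?b * (ipow (p + r) x * iexp (u * x)) + ?d * (wt x * of_real (rem_value p x)) \<partial>M)"
    by (intro integral_cong_AE) auto
  also have "\<dots> = (\<integral>x. ?b * (ipow (p + r) x * iexp (u * x)) \<partial>M) + (\<integral>x. ?d * (wt x * of_real (rem_value p x)) \<partial>M)"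
    by (rule Bochner_Integration.integral_add) (intro integrable_mult_right i1 i2)+
  also have "\<dots> = ?b * frac_deriv (p + r) (char M) u + ?d * (\<integral>x. wt x * of_real (rem_value p x) \<partial>M)"
    unfolding frac_deriv_char[OF mpr] fourier_def by simp
  also have "?d * (\<integral>x. wt x * of_real (rem_value p x) \<partial>M) =
      of_real (Gamma (p + 1)) / (2 * of_real pi * \<i> powr of_real r) * set_lebesgue_integral lebesgue {0<..} F"
    unfolding times_divide_eq_left I by simp
  finally show "(\<integral>x. of_real (pos_power x (r + p)) * iexp (u * x) \<partial>M)
      = frac_deriv (p + r) (char M) u / (2 * \<i> powr of_real (p + r)) * of_bool (p \<in> \<nat>)
      + of_real (Gamma (p + 1)) / (2 * of_real pi * \<i> powr of_real r)
        * set_lebesgue_integral lebesgue {0<..} F"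
    by simp
qed

end

theorem corollary3p1:
  fixes M :: "'a measure" and X :: "'a \<Rightarrow> real"
    and p r u :: real and f :: "real \<Rightarrow> complex" and l :: nat
    and F :: "real \<Rightarrow> complex"
  assumes "prob_space M"
    and "X \<in> borel_measurable M"
    and "p > 0"
    and "abs_moment M X r + abs_moment M X (r + p) < \<infinity>"
    and "f = char (distr M borel X)"
    and "l = nat \<lceil>p - 1\<rceil>"
    and "F = (\<lambda>t::real.
      taylor_rem l (frac_deriv r f) u t / (\<i> * of_real t) powr of_real (p + 1)
    + taylor_rem l (frac_deriv r f) u (- t) / (- \<i> * of_real t) powr of_real (p + 1))"
  shows "set_integrable lebesgue {0<..} F \<and>
    (\<integral>\<omega>. of_real (pos_power (X \<omega>) (r + p)) * exp (\<i> * of_real (u * X \<omega>)) \<partial>M)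
      = frac_deriv (p + r) f u / (2 * \<i> powr of_real (p + r)) * of_bool (p \<in> \<nat>)
      + of_real (Gamma (p + 1)) / (2 * of_real pi * \<i> powr of_real r)
        * set_lebesgue_integral lebesgue {0<..} F"
proof -
  interpret D: real_distribution "distr M borel X"
    using prob_space.real_distribution_distr[OF assms(1,2)] .
  have mr: "has_moment (distr M borel X) r" and mp: "has_moment (distr M borel X) (r + p)"
    using assms(4) by (auto intro!: has_moment_distr[OF assms(2)])
  have [measurable]: "X \<in> borel_measurable M" "(\<lambda>x. pos_power x (r + p)) \<in> borel_measurable borel"
    using assms(2) by (auto simp: pos_power_def)
  have "(\<integral>\<omega>. of_real (pos_power (X \<omega>) (r + p)) * exp (\<i> * of_real (u * X \<omega>)) \<partial>M) =
      (\<integral>x. of_real (pos_power x (r + p)) * iexp (u * x) \<partial>distr M borel X)"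
    by (simp add: integral_distr)
  then show ?thesis
    using D.pos_power_moment[OF assms(3) mr mp assms(6) assms(7)[unfolded assms(5)]] assms(5) by simp
qed

end
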